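(* Let $\psi:\mathcal{H}\to\mathbb{R}$ be convex and of class $C^2$, let $V(x)=\frac12\|\nabla\psi(x)\|^2$ for $x\in\mathcal{H}$, and let $u_0\in\mathcal{H}$. The second order system $v''(t)=\nabla V(v(t))$, $t\ge 0$, has a w-evanescent solution $v$ satisfying $v(0)=u_0$ if and only if $\inf_{z\in\mathcal{H}}\|\nabla\psi(z)\|=0$. In this case, $v$ is unique (among w-evanescent solutions with $v(0)=u_0$), and $v$ is also the unique solution of the first order system $u'(t)=-\nabla\psi(u(t))$, $t\ge0$, satisfying $u(0)=u_0$. Moreover (in this case): (i) $v$ is strongly evanescent if and only if $\psi$ is bounded below; (ii) $v$ is bounded if and only if $\mathrm{Crit}_\psi\neq\emptyset$.
   Context: $\mathcal{H}$ is a real Hilbert space with inner product $\langle\cdot\mid\cdot\rangle$ and norm $\|\cdot\|$. $\mathrm{Crit}_\psi=\{x\in\mathcal{H}:\nabla\psi(x)=0\}$. A global solution of $v''(t)=\nabla V(v(t))$ is a function $v\in C^2([0,+\infty),\mathcal{H})$ satisfying the equation for all $t\ge 0$. A global solution $v$ is called w-evanescent (weakly evanescent) if $\liminf_{t\to+\infty}\|v'(t)\|=\liminf_{t\to+\infty}V(v(t))=0$, and strongly evanescent if $\int_0^{+\infty}\left(\|v'(t)\|^2+V(v(t))\right)dt<+\infty$. *)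

theory Defs
  imports "HOL-Analysis.Analysis"
begin

text \<open>
  Real Hilbert spaces are types of sort \<open>{real_inner, complete_space}\<close>.
\<close>

definition grad :: "('a::real_inner \<Rightarrow> real) \<Rightarrow> 'a \<Rightarrow> 'a" where
  "grad f x = (THE g. GDERIV f x :> g)"

text \<open>
  Class \<open>C\<^sup>2\<close> in the Frechet sense: the derivative, as a map into the dual space with the
  operator norm, is itself continuously differentiable.
\<close>

definition class_C2 :: "('a::real_normed_vector \<Rightarrow> real) \<Rightarrow> bool" where
  "class_C2 f \<longleftrightarrow>
    (\<exists>(f' :: 'a \<Rightarrow> 'a \<Rightarrow>\<^sub>L real) (f'' :: 'a \<Rightarrow> 'a \<Rightarrow>\<^sub>L ('a \<Rightarrow>\<^sub>L real)).
      (\<forall>x. (f has_derivative blinfun_apply (f' x)) (at x)) \<and>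
      (\<forall>x. (f' has_derivative blinfun_apply (f'' x)) (at x)) \<and>
      continuous_on UNIV f'')"

definition Crit :: "('a::real_inner \<Rightarrow> real) \<Rightarrow> 'a set" where
  "Crit f = {x. grad f x = 0}"

text \<open>
  Trajectories are total functions on \<open>real\<close> of which only the restriction to \<open>{0..}\<close> matters;
  derivatives are taken within \<open>{0..}\<close>, hence are one-sided at \<open>0\<close>.
\<close>

definition tderiv :: "(real \<Rightarrow> 'a::real_normed_vector) \<Rightarrow> real \<Rightarrow> 'a" where
  "tderiv v t = vector_derivative v (at t within {0..})"

definition traj_C2 :: "(real \<Rightarrow> 'a::real_normed_vector) \<Rightarrow> bool" where
  "traj_C2 v \<longleftrightarrow>
    (\<exists>v' v''.
      (\<forall>t\<ge>0. (v has_vector_derivative v' t) (at t within {0..})) \<and>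
      (\<forall>t\<ge>0. (v' has_vector_derivative v'' t) (at t within {0..})) \<and>
      continuous_on {0..} v'')"

definition global_solution :: "('a::real_inner \<Rightarrow> real) \<Rightarrow> (real \<Rightarrow> 'a) \<Rightarrow> bool" where
  "global_solution V v \<longleftrightarrow>
    traj_C2 v \<and> (\<forall>t\<ge>0. tderiv (tderiv v) t = grad V (v t))"

definition w_evanescent :: "('a::real_inner \<Rightarrow> real) \<Rightarrow> (real \<Rightarrow> 'a) \<Rightarrow> bool" where
  "w_evanescent V v \<longleftrightarrow>
    global_solution V v \<and>
    Liminf at_top (\<lambda>t. ereal (norm (tderiv v t))) = 0 \<and>
    Liminf at_top (\<lambda>t. ereal (V (v t))) = 0"

text \<open>
  Intended for \<open>V \<ge> 0\<close>: \<open>ennreal\<close> truncates negative values to \<open>0\<close>.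
\<close>

definition strongly_evanescent :: "('a::real_inner \<Rightarrow> real) \<Rightarrow> (real \<Rightarrow> 'a) \<Rightarrow> bool" where
  "strongly_evanescent V v \<longleftrightarrow>
    global_solution V v \<and>
    (\<integral>\<^sup>+t\<in>{0..}. ennreal ((norm (tderiv v t))\<^sup>2 + V (v t)) \<partial>lborel) < \<infinity>"

text \<open>
  Continuity of \<open>u'\<close> is not required separately: it is automatic when \<open>grad f\<close> is continuous.
\<close>

definition gradient_flow :: "('a::real_inner \<Rightarrow> real) \<Rightarrow> (real \<Rightarrow> 'a) \<Rightarrow> bool" where
  "gradient_flow f u \<longleftrightarrow>
    (\<forall>t\<ge>0. (u has_vector_derivative - grad f (u t)) (at t within {0..}))"

end

theory Submission
  imports Defs
begin

text \<open>
Let \<open>g\<close> be the gradient of \<open>\<psi>\<close> and \<open>A\<close> its Hessian, a symmetric and, by convexity, nonnegative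
operator at each point. Then the gradient of \<open>V\<close> is \<open>A x (g x)\<close>, and the second order equation
\<open>v'' = A v (g v)\<close> factors: the defect \<open>w = v' + g v\<close> satisfies \<open>w' = A v w\<close>. A trajectory of the
gradient flow is a solution with \<open>w = 0\<close>. Conversely \<open>norm w\<close> never decreases, while weak evanescence
and conservation of energy make it arbitrarily small at late times; so every w-evanescent solution
follows the gradient flow (\<open>w_evanescent_imp_gradient_flow\<close>). Since \<open>g\<close> is monotone, the flow is
nonexpansive, and uniqueness for given initial data follows.

It remains to analyse the flow itself. As \<open>g\<close> is monotone and locally Lipschitz, Picard iteration
together with the fact that the speed of a trajectory does not increase gives trajectories for all
times (\<open>dissipative_flow_exists\<close>). If \<open>norm (g z)\<close> can be made arbitrarily small, then
\<open>g\<close> tends to zero along each trajectory (\<open>gradient_vanishes_along_flow\<close>), so that the flow is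
w-evanescent; if a w-evanescent solution exists, the values of \<open>g\<close> along it show that the infimum is
zero. Strong evanescence is decided by integrating the dissipation \<open>- (\<psi> (u t))' = norm (g (u t)) ^ 2\<close>
and by the fact that the flow decreases \<open>\<psi>\<close> to its global infimum. Finally, a trajectory near a
critical point cannot escape from it, and the asymptotic center of a bounded trajectory is
fixed by the flow, hence critical (\<open>bounded_flow_iff\<close>).

All existence statements in infinite dimension (the Riesz representation, which provides gradients and
primitives of curves, and the asymptotic center) come from one principle: a continuous, strongly
midpoint convex function that is bounded below attains its infimum, because minimizing sequences are
Cauchy.
\<close>

section \<open>Minimization and Riesz representation\<close>

text \<open>
By strong midpoint convexity the squared distance of two points is controlled by how far their
values lie above the infimum, so every minimizing sequence is Cauchy. This replaces weak
compactness: it yields the representing vector of a functional, and later the asymptotic center of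
a bounded trajectory.
\<close>

lemma strongly_midconvex_attains_unique_minimum:
  fixes f :: "'a::{real_inner, complete_space} \<Rightarrow> real"
  assumes "c > 0" and mid: "\<And>x y. f ((1/2) *\<^sub>R (x + y)) \<le> (f x + f y) / 2 - c * (norm (x - y))\<^sup>2"
    and cont: "continuous_on UNIV f" and bdd: "bdd_below (range f)"
  obtains x where "\<And>y. f x \<le> f y" and "\<And>y. f y \<le> f x \<Longrightarrow> y = x"
proof -
  define m where "m = (INF x. f x)"
  have m: "m \<le> f x" for x
    unfolding m_def by (rule cINF_lower[OF bdd]) simp
  have "\<exists>x. f x < m + 1 / real (Suc n)" for n
    using cINF_less_iff[OF _ bdd, of "m + 1 / real (Suc n)"] by (auto simp: m_def)
  then obtain s where s: "f (s n) < m + 1 / real (Suc n)" for n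
    by metis
  have gap: "2 * (c * (norm (x - y))\<^sup>2) \<le> (f x - m) + (f y - m)" for x y
    using mid[of x y] m[of "(1/2) *\<^sub>R (x + y)"] by (simp add: field_simps)
  have "Cauchy s"
  proof (rule CauchyI)
    fix e :: real assume "e > 0"
    obtain N where N: "1 / real (Suc N) < c * e\<^sup>2"
      using nat_approx_posE[of "c * e\<^sup>2"] \<open>e > 0\<close> \<open>c > 0\<close> by auto
    have small: "f (s n) - m < c * e\<^sup>2" if "n \<ge> N" for n
    proof -
      have "1 / real (Suc n) \<le> 1 / real (Suc N)"
        using that by (simp add: field_simps)
      with s[of n] N show ?thesis by linarith
    qed
    have "norm (s i - s j) < e" if "i \<ge> N" "j \<ge> N" for i j
    proof -
      have "c * (norm (s i - s j))\<^sup>2 < c * e\<^sup>2"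
        using gap[of "s i" "s j"] small[OF that(1)] small[OF that(2)] by simp
      with \<open>c > 0\<close> \<open>e > 0\<close> show ?thesis
        by (auto intro: power2_less_imp_less)
    qed
    then show "\<exists>M. \<forall>i\<ge>M. \<forall>j\<ge>M. norm (s i - s j) < e" by blast
  qed
  then obtain x where x: "s \<longlonglongrightarrow> x"
    using Cauchy_convergent convergent_def by blast
  have "(\<lambda>n. f (s n)) \<longlonglongrightarrow> f x"
    using continuous_on_tendsto_compose[OF cont x] by simp
  moreover have "(\<lambda>n. m + 1 / real (Suc n)) \<longlonglongrightarrow> m + 0"
    by (intro tendsto_intros LIMSEQ_Suc lim_1_over_n)
  ultimately have "f x \<le> m + 0"
    by (rule LIMSEQ_le) (use s in \<open>auto intro: less_imp_le\<close>)
  then have min: "f x \<le> f y" for y using m[of y] by simp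
  moreover have "y = x" if "f y \<le> f x" for y
  proof -
    have "c * (norm (y - x))\<^sup>2 \<le> 0"
      using gap[of y x] that \<open>f x \<le> m + 0\<close> by linarith
    then show ?thesis
      using \<open>c > 0\<close> by (auto simp: mult_le_0_iff)
  qed
  ultimately show ?thesis using that by blast
qed

lemma norm_midpoint_sq:
  fixes x y z :: "'a::real_inner"
  shows "(norm (z - (1/2) *\<^sub>R (x + y)))\<^sup>2
    = ((norm (z - x))\<^sup>2 + (norm (z - y))\<^sup>2) / 2 - (1/4) * (norm (x - y))\<^sup>2"
  by (simp add: power2_norm_eq_inner inner_diff_left inner_diff_right inner_add_left
      inner_add_right inner_commute algebra_simps) (simp add: field_simps)

text \<open>
The representing vector is the minimizer of \<open>norm x ^ 2 - 2 * l x\<close>: the parallelogram law makes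
this function strongly midpoint convex, and its derivative at the minimizer vanishes in every
direction \<open>h\<close>.
\<close>

lemma Riesz_representation:
  fixes l :: "'a::{real_inner, complete_space} \<Rightarrow> real"
  assumes "bounded_linear l"
  obtains r where "\<And>h. l h = r \<bullet> h"
proof -
  interpret bounded_linear l by fact
  obtain K where K: "\<And>x. norm (l x) \<le> norm x * K" using bounded by blast
  let ?f = "\<lambda>x. (norm x)\<^sup>2 - 2 * l x"
  have "\<exists>x. (\<forall>y. ?f x \<le> ?f y)"
  proof (rule strongly_midconvex_attains_unique_minimum[of "1/4" ?f])
    show "?f ((1/2) *\<^sub>R (x + y)) \<le> (?f x + ?f y) / 2 - (1/4) * (norm (x - y))\<^sup>2" for x y
      using norm_midpoint_sq[of 0 x y] unfolding diff_0 norm_minus_cancel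
      by (simp add: scaleR add algebra_simps del: scaleR_right_distrib)
    show "continuous_on UNIV ?f"
      by (intro continuous_intros linear_continuous_on bounded_linear_axioms)
    \<comment> \<open>Complete the square: \<open>norm x ^ 2 - 2 * K * norm x \<ge> - K ^ 2\<close>.\<close>
    have "- K\<^sup>2 \<le> ?f x" for x
      using K[of x] zero_le_power2[of "norm x - K"] by (simp add: power2_diff abs_le_iff)
    then show "bdd_below (range ?f)" by (auto intro!: bdd_belowI)
  qed auto
  then obtain x where min: "\<And>y. ?f x \<le> ?f y" by blast
  have "l h = x \<bullet> h" for h
  proof -
    have "((\<lambda>s. ?f (x + s *\<^sub>R h)) has_real_derivative 2 * (x \<bullet> h) - 2 * l h) (at 0)"
      unfolding power2_norm_eq_inner scaleR add
      by (auto intro!: derivative_eq_intros simp: inner_commute algebra_simps scaleR)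
    then have "2 * (x \<bullet> h) - 2 * l h = 0"
      by (rule DERIV_local_min[where d = 1]) (use min in auto)
    then show ?thesis by simp
  qed
  then show ?thesis using that by blast
qed

lemma norm_le_if_inner_le:
  fixes y :: "'a::real_inner"
  assumes "\<And>h. y \<bullet> h \<le> c * norm h" "0 \<le> c"
  shows "norm y \<le> c"
proof (cases "y = 0")
  case False
  have "norm y * norm y \<le> c * norm y"
    using assms(1)[of y] by (simp add: dot_square_norm power2_eq_square)
  with False show ?thesis by simp
qed (use assms in simp)

section \<open>Flows of dissipative vector fields\<close>

text \<open>
The primitive is first constructed weakly: \<open>F t\<close> represents the functional sending \<open>h\<close> to the real
integral of \<open>f s \<bullet> h\<close> over \<open>{0..t}\<close>. For each \<open>h\<close> this is differentiable, and the remainder is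
bounded by the oscillation of \<open>f\<close> times \<open>norm h\<close>. Since that bound is uniform in \<open>h\<close>,
differentiability in norm follows.
\<close>

lemma continuous_has_primitive:
  fixes f :: "real \<Rightarrow> 'a::{real_inner, complete_space}"
  assumes cont: "continuous_on {0..T} f"
  obtains F where "F 0 = 0"
    and "\<And>t. t \<in> {0..T} \<Longrightarrow> (F has_vector_derivative f t) (at t within {0..T})"
proof -
  have cont_h: "continuous_on {0..T} (\<lambda>s. f s \<bullet> h)" for h
    by (intro continuous_intros cont)
  have "bounded (f ` {0..T})"
    by (intro compact_imp_bounded compact_continuous_image cont) simp
  then obtain M where M: "\<And>s. s \<in> {0..T} \<Longrightarrow> norm (f s) \<le> M"
    by (metis (no_types, lifting) bounded_iff imageI)
  have int_h: "(\<lambda>s. f s \<bullet> h) integrable_on {0..t}" if "t \<le> T" for t h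
    by (rule integrable_continuous_real, rule continuous_on_subset[OF cont_h]) (use that in auto)
  define I where "I t h = integral {0..t} (\<lambda>s. f s \<bullet> h)" for t h
  have "\<exists>r. \<forall>h. I t h = r \<bullet> h" if t: "t \<in> {0..T}" for t
  proof -
    have "bounded_linear (I t)"
    proof (rule bounded_linear_intro)
      show "I t (x + y) = I t x + I t y" for x y
        unfolding I_def inner_add_right using t by (intro integral_add int_h) auto
      show "I t (c *\<^sub>R x) = c *\<^sub>R I t x" for c x
        unfolding I_def by simp
      show "norm (I t x) \<le> norm x * (M * t)" for x
      proof -
        have "norm (I t x) \<le> (M * norm x) * (t - 0)"
          unfolding I_def
        proof (rule integral_bound)
          show "norm (f s \<bullet> x) \<le> M * norm x" if "s \<in> {0..t}" for s
          proof -
            have "norm (f s \<bullet> x) \<le> norm (f s) * norm x" by (simp add: Cauchy_Schwarz_ineq2)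
            also have "\<dots> \<le> M * norm x" using M[of s] that t by (intro mult_right_mono) auto
            finally show ?thesis .
          qed
        qed (use t in \<open>auto intro: continuous_on_subset[OF cont_h]\<close>)
        then show ?thesis by (simp add: mult_ac)
      qed
    qed
    then show ?thesis using Riesz_representation by metis
  qed
  then obtain F where F: "\<And>t h. t \<in> {0..T} \<Longrightarrow> I t h = F t \<bullet> h" by metis
  \<comment> \<open>For negative \<open>T\<close> the value \<open>F 0\<close> is unspecified, so it is set to zero.\<close>
  define F0 where "F0 t = (if t = 0 then 0 else F t)" for t
  have F0: "I t h = F0 t \<bullet> h" if "t \<in> {0..T}" for t h
    using F[OF that, of h] by (auto simp: F0_def I_def)
  have D: "((\<lambda>t. F0 t \<bullet> h) has_vector_derivative f t \<bullet> h) (at t within {0..T})"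
    if t: "t \<in> {0..T}" for t h
    using integral_has_vector_derivative[OF cont_h[of h] t]
    by (rule has_vector_derivative_transform[rotated 2]) (use t F0 in \<open>auto simp: I_def\<close>)
  have "(F0 has_vector_derivative f t) (at t within {0..T})" if t: "t \<in> {0..T}" for t
    unfolding has_vector_derivative_def has_derivative_within_alt
  proof (intro conjI allI impI bounded_linear_scaleR_left)
    fix e :: real assume "e > 0"
    obtain d where "d > 0" and d: "\<And>s. s \<in> {0..T} \<Longrightarrow> dist s t < d \<Longrightarrow> dist (f s) (f t) < e"
      using cont t \<open>e > 0\<close> unfolding continuous_on_iff by metis
    have "norm (F0 s - F0 t - (s - t) *\<^sub>R f t) \<le> e * norm (s - t)"
      if s: "s \<in> {0..T}" "norm (s - t) < d" for s
    proof (rule norm_le_if_inner_le)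
      fix h
      let ?S = "closed_segment t s"
      have sub: "?S \<subseteq> {0..T}" using s t by (auto simp: closed_segment_eq_real_ivl)
      have "norm (F0 s \<bullet> h - F0 t \<bullet> h - (s - t) *\<^sub>R (f t \<bullet> h)) \<le> norm (s - t) * (e * norm h)"
      proof (rule vector_differentiable_bound_linearization[where S = ?S and f' = "\<lambda>r. f r \<bullet> h"])
        fix r assume r: "r \<in> ?S"
        show "((\<lambda>r. F0 r \<bullet> h) has_vector_derivative f r \<bullet> h) (at r within ?S)"
          using D sub r by (blast intro: has_vector_derivative_within_subset)
        have "dist r t < d"
          using r s(2) by (auto simp: dist_real_def closed_segment_eq_real_ivl split: if_splits)
        then have "norm (f r - f t) \<le> e" using d[of r] r sub by (auto simp: dist_norm)
        then show "norm (f r \<bullet> h - f t \<bullet> h) \<le> e * norm h"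
          unfolding inner_diff_left[symmetric] real_norm_def
          by (meson Cauchy_Schwarz_ineq2 mult_right_mono norm_ge_zero order_trans)
      qed auto
      then show "(F0 s - F0 t - (s - t) *\<^sub>R f t) \<bullet> h \<le> e * norm (s - t) * norm h"
        by (simp add: inner_diff_left mult_ac abs_le_iff)
    qed (use \<open>e > 0\<close> in auto)
    with \<open>d > 0\<close> show "\<exists>d>0. \<forall>y\<in>{0..T}. norm (y - t) < d \<longrightarrow>
      norm (F0 y - F0 t - (y - t) *\<^sub>R f t) \<le> e * norm (y - t)" by blast
  qed
  moreover have "F0 0 = 0" by (simp add: F0_def)
  ultimately show ?thesis using that by blast
qed

lemma norm_diff_le_of_vector_derivative:
  fixes f :: "real \<Rightarrow> 'a::real_normed_vector"
  assumes "convex S" "\<And>t. t \<in> S \<Longrightarrow> (f has_vector_derivative f' t) (at t within S)"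
    and "\<And>t. t \<in> S \<Longrightarrow> norm (f' t) \<le> B" "s \<in> S" "t \<in> S"
  shows "norm (f t - f s) \<le> B * \<bar>t - s\<bar>"
proof -
  have "onorm (\<lambda>h. h *\<^sub>R f' r) \<le> B" if "r \<in> S" for r
    using assms(3)[OF that] by (intro onorm_le) (auto simp: mult.commute[of B] intro: mult_left_mono)
  then have "norm (f t - f s) \<le> B * norm (t - s)"
    using assms unfolding has_vector_derivative_def
    by (intro differentiable_bound[where f' = "\<lambda>t h. h *\<^sub>R f' t" and S = S]) auto
  then show ?thesis by simp
qed

lemma antimono_of_derivative_nonpos:
  fixes f :: "real \<Rightarrow> real"
  assumes "a \<le> b"
    and der: "\<And>t. t \<in> {a..b} \<Longrightarrow> (f has_real_derivative f' t) (at t within {a..b})"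
    and nonpos: "\<And>t. t \<in> {a..b} \<Longrightarrow> f' t \<le> 0"
  shows "f b \<le> f a"
proof (rule DERIV_nonpos_imp_decreasing_open[OF \<open>a \<le> b\<close>])
  show "\<exists>y. DERIV f t :> y \<and> y \<le> 0" if "a < t" "t < b" for t
    using der[of t] nonpos[of t] that by (auto simp: at_within_Icc_at)
  show "continuous_on {a..b} f"
    using der DERIV_continuous_on by blast
qed

text \<open>
The norm grows no faster than its radial derivative \<open>w' \<bullet> w / norm w\<close>. It may fail to be
differentiable where \<open>w\<close> vanishes, so the proof differentiates \<open>sqrt (norm w ^ 2 + e ^ 2)\<close> and
lets \<open>e\<close> tend to zero. With \<open>c = 0\<close> this gives contraction and monotonicity statements, with
\<open>c > 0\<close> linear growth bounds.
\<close>

lemma norm_growth_of_radial_speed: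
  fixes w :: "real \<Rightarrow> 'a::real_inner"
  assumes "a \<le> b" "0 \<le> c"
    and der: "\<And>t. t \<in> {a..b} \<Longrightarrow> (w has_vector_derivative w' t) (at t within {a..b})"
    and radial: "\<And>t. t \<in> {a..b} \<Longrightarrow> w' t \<bullet> w t \<le> c * norm (w t)"
  shows "norm (w b) \<le> norm (w a) + c * (b - a)"
proof (rule field_le_epsilon)
  fix e :: real assume "e > 0"
  define q where "q t = w t \<bullet> w t + e\<^sup>2" for t
  have q_pos: "q t > 0" for t
    unfolding q_def using \<open>e > 0\<close> by (simp add: add_nonneg_pos)
  have q_ge: "norm (w t) \<le> sqrt (q t)" for t
    unfolding q_def by (simp add: norm_eq_sqrt_inner)
  have "sqrt (q b) - c * b \<le> sqrt (q a) - c * a"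
  proof (rule antimono_of_derivative_nonpos[OF \<open>a \<le> b\<close>])
    fix t assume t: "t \<in> {a..b}"
    have "((\<lambda>t. w t \<bullet> w t) has_vector_derivative w t \<bullet> w' t + w' t \<bullet> w t) (at t within {a..b})"
      by (rule bounded_bilinear.has_vector_derivative[OF bounded_bilinear_inner der der]) (use t in auto)
    then have "(q has_real_derivative 2 * (w' t \<bullet> w t)) (at t within {a..b})"
      unfolding q_def has_real_derivative_iff_has_vector_derivative[symmetric]
      by (auto intro!: derivative_eq_intros simp: inner_commute)
    then show "((\<lambda>t. sqrt (q t) - c * t) has_real_derivative (w' t \<bullet> w t) / sqrt (q t) - c)
        (at t within {a..b})"
      using q_pos[of t] by (auto intro!: derivative_eq_intros simp: field_simps)
    have "w' t \<bullet> w t \<le> c * sqrt (q t)"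
      using radial[OF t] mult_left_mono[OF q_ge[of t] \<open>0 \<le> c\<close>] by linarith
    then show "(w' t \<bullet> w t) / sqrt (q t) - c \<le> 0"
      using q_pos[of t] by (simp add: divide_le_eq)
  qed
  moreover have "sqrt (q a) \<le> norm (w a) + e"
    using sqrt_add_le_add_sqrt[of "w a \<bullet> w a" "e\<^sup>2"] \<open>e > 0\<close>
    by (simp add: q_def norm_eq_sqrt_inner)
  ultimately show "norm (w b) \<le> norm (w a) + c * (b - a) + e"
    using q_ge[of b] by (simp add: algebra_simps)
qed

definition flow_on :: "('a::real_normed_vector \<Rightarrow> 'a) \<Rightarrow> real \<Rightarrow> (real \<Rightarrow> 'a) \<Rightarrow> bool" where
  "flow_on G T u \<longleftrightarrow> (\<forall>t\<in>{0..T}. (u has_vector_derivative G (u t)) (at t within {0..T}))"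

lemma flow_on_mono: "flow_on G T u \<Longrightarrow> S \<le> T \<Longrightarrow> flow_on G S u"
  unfolding flow_on_def by (auto intro: has_vector_derivative_within_subset[where S = "{0..T}"])

lemma flow_on_shift:
  assumes "flow_on G T u" "0 \<le> s" 
  shows "flow_on G (T - s) (\<lambda>t. u (t + s))"
  unfolding flow_on_def
proof
  fix t assume t: "t \<in> {0..T - s}"
  have "(u has_vector_derivative G (u (t + s))) (at (t + s) within (\<lambda>t. t + s) ` {0..T - s})"
    by (rule has_vector_derivative_within_subset[where S = "{0..T}"])
      (use assms t in \<open>auto simp: flow_on_def\<close>)
  moreover have "((\<lambda>t. t + s) has_vector_derivative 1) (at t within {0..T - s})"
    by (auto intro!: derivative_eq_intros)
  ultimately show "((\<lambda>t. u (t + s)) has_vector_derivative G (u (t + s))) (at t within {0..T - s})"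
    using vector_diff_chain_within[of "\<lambda>t. t + s" 1 t "{0..T - s}" u]
    by (simp add: o_def)
qed

lemma flow_on_concat:
  assumes u: "flow_on G S u" and w: "flow_on G T w" and "w 0 = u S" "0 \<le> S" "0 \<le> T"
  shows "flow_on G (S + T) (\<lambda>t. if t \<in> {0..S} then u t else w (t - S))"
  unfolding flow_on_def
proof
  fix t assume t: "t \<in> {0..S + T}"
  have un: "{0..S + T} = {0..S} \<union> {S..S + T}"
    using \<open>0 \<le> S\<close> \<open>0 \<le> T\<close> by auto
  have int: "{0..S} \<union> (closure {0..S} \<inter> closure {S..S + T}) = {0..S}"
       "{S..S + T} \<union> (closure {0..S} \<inter> closure {S..S + T}) = {S..S + T}"
    using \<open>0 \<le> S\<close> \<open>0 \<le> T\<close> by auto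
  have w': "((\<lambda>t. w (t - S)) has_vector_derivative G (w (r - S))) (at r within {S..S + T})"
    if "r \<in> {S..S + T}" for r
  proof -
    have "(w has_vector_derivative G (w (r - S))) (at (r - S) within (\<lambda>t. t - S) ` {S..S + T})"
      by (rule has_vector_derivative_within_subset[where S = "{0..T}"])
        (use w that in \<open>auto simp: flow_on_def\<close>)
    moreover have "((\<lambda>t. t - S) has_vector_derivative 1) (at r within {S..S + T})"
      by (auto intro!: derivative_eq_intros)
    ultimately show ?thesis
      using vector_diff_chain_within[of "\<lambda>t. t - S" 1 r "{S..S + T}" w]
      by (simp add: o_def)
  qed
  have "((\<lambda>t. if t \<in> {0..S} then u t else w (t - S)) has_vector_derivative
     (if t \<in> {0..S} then G (u t) else G (w (t - S)))) (at t within {0..S + T})"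
  proof (rule has_vector_derivative_If_within_closures[where T = "{S..S + T}"])
    show "t \<in> {0..S} \<union> {S..S + T}" using t by auto
  qed (use u w' w'[of S] un int assms in \<open>auto simp: flow_on_def\<close>)
  then show "((\<lambda>t. if t \<in> {0..S} then u t else w (t - S)) has_vector_derivative
      G (if t \<in> {0..S} then u t else w (t - S))) (at t within {0..S + T})"
    by (simp add: if_distrib)
qed

text \<open>
Picard iteration: integration of \<open>G\<close> along a curve is a contraction on the closed set of continuous
curves with values in \<open>cball x r\<close>. Curves are bounded continuous functions on the whole line; the
integral curve is made constant outside \<open>{0..T}\<close> by clamping time to that interval.
\<close>

lemma local_flow_exists:
  fixes G :: "'a::{real_inner, complete_space} \<Rightarrow> 'a"
  assumes lip: "L-lipschitz_on (cball x r) G" and M: "\<And>y. y \<in> cball x r \<Longrightarrow> norm (G y) \<le> M"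
    and "0 \<le> r" "0 < T" "T * M \<le> r" "T * L \<le> 1/2"
  obtains u where "u 0 = x" "flow_on G T u"
proof -
  have "0 \<le> L" using lip by (rule lipschitz_on_nonneg)
  have "0 \<le> M"
    using M[of x] \<open>0 \<le> r\<close> norm_ge_zero[of "G x"] by (auto simp del: norm_ge_zero)
  define S where "S = PiC UNIV (\<lambda>_::real. cball x r)"
  have S: "apply_bcontfun u t \<in> cball x r" if "u \<in> S" for u t
    using that by (auto simp: S_def mem_PiC_iff)
  have "\<exists>P. P 0 = 0 \<and> (\<forall>t\<in>{0..T}. (P has_vector_derivative G (apply_bcontfun u t)) (at t within {0..T}))"
    if "u \<in> S" for u
  proof -
    have "continuous_on {0..T} (\<lambda>t. G (apply_bcontfun u t))"
      by (rule continuous_on_compose2[OF lipschitz_on_continuous_on[OF lip]])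
        (use S[OF that] in auto)
    then show ?thesis by (rule continuous_has_primitive) blast
  qed
  then obtain P where P0: "\<And>u. u \<in> S \<Longrightarrow> P u 0 = 0"
    and P: "\<And>u t. u \<in> S \<Longrightarrow> t \<in> {0..T} \<Longrightarrow>
      (P u has_vector_derivative G (apply_bcontfun u t)) (at t within {0..T})"
    by metis
  define cl where "cl t = max 0 (min T t)" for t :: real
  have cl: "cl t \<in> {0..T}" "t \<in> {0..T} \<Longrightarrow> cl t = t" for t
    using \<open>0 < T\<close> by (auto simp: cl_def)
  have cl_cont: "continuous_on UNIV cl"
    unfolding cl_def by (intro continuous_intros)
  have P_le: "norm (P u t) \<le> r" if "u \<in> S" "t \<in> {0..T}" for u t
  proof -
    have "norm (P u t - P u 0) \<le> M * \<bar>t - 0\<bar>"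
      by (rule norm_diff_le_of_vector_derivative[OF _ P[OF that(1)] M[OF S[OF that(1)]]])
        (use that \<open>0 < T\<close> in auto)
    also have "\<dots> \<le> M * T"
      using that \<open>0 \<le> M\<close> by (auto intro: mult_left_mono)
    finally show ?thesis using P0[OF that(1)] assms by (simp add: mult.commute)
  qed
  define \<Phi> where "\<Phi> u = Bcontfun (\<lambda>t. x + P u (cl t))" for u
  have \<Phi>: "apply_bcontfun (\<Phi> u) t = x + P u (cl t)" if "u \<in> S" for u t
  proof -
    have "continuous_on {0..T} (P u)"
      using P[OF that] by (meson continuous_on_eq_continuous_within has_vector_derivative_continuous)
    then have "continuous_on UNIV (\<lambda>t. P u (cl t))"
      by (rule continuous_on_compose2[OF _ cl_cont]) (use cl in auto)
    moreover have "bounded (range (\<lambda>t. x + P u (cl t)))"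
      by (rule boundedI[where B = "norm x + r"])
        (use P_le[OF that] cl in \<open>auto intro!: norm_triangle_le add_left_mono\<close>)
    ultimately show ?thesis
      unfolding \<Phi>_def by (subst Bcontfun_inverse) (auto simp: bcontfun_def intro!: continuous_intros)
  qed
  have "\<exists>!u\<in>S. \<Phi> u = u"
  proof (rule Banach_fix)
    show "complete S"
      unfolding S_def by (intro complete_eq_closed[THEN iffD2] closed_PiC) auto
    have "const_bcontfun x \<in> S"
      using \<open>0 \<le> r\<close> by (auto simp: S_def mem_PiC_iff const_bcontfun.rep_eq)
    then show "S \<noteq> {}" by blast
    show "\<Phi> ` S \<subseteq> S"
      using P_le cl by (auto simp: S_def mem_PiC_iff \<Phi>[unfolded S_def mem_PiC_iff] dist_norm)
    show "dist (\<Phi> u) (\<Phi> w) \<le> (1/2) * dist u w" if "u \<in> S" "w \<in> S" for u w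
    proof (rule dist_bound)
      fix t
      have "norm ((P u (cl t) - P w (cl t)) - (P u 0 - P w 0)) \<le> (L * dist u w) * \<bar>cl t - 0\<bar>"
      proof (rule norm_diff_le_of_vector_derivative[where S = "{0..T}"])
        fix s assume s: "s \<in> {0..T}"
        show "((\<lambda>t. P u t - P w t) has_vector_derivative
            G (apply_bcontfun u s) - G (apply_bcontfun w s)) (at s within {0..T})"
          using P s that by (intro has_vector_derivative_diff) auto
        have "norm (G (apply_bcontfun u s) - G (apply_bcontfun w s))
            \<le> L * dist (apply_bcontfun u s) (apply_bcontfun w s)"
          using lipschitz_onD[OF lip] S that by (simp add: dist_norm)
        also have "\<dots> \<le> L * dist u w"
          using \<open>0 \<le> L\<close> by (intro mult_left_mono dist_bounded)
        finally show "norm (G (apply_bcontfun u s) - G (apply_bcontfun w s)) \<le> L * dist u w" .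
      qed (use cl \<open>0 < T\<close> in auto)
      also have "\<dots> \<le> (L * dist u w) * T"
        using cl[of t] \<open>0 \<le> L\<close> by (intro mult_left_mono) auto
      also have "\<dots> = (T * L) * dist u w" by simp
      also have "\<dots> \<le> (1/2) * dist u w"
        using \<open>T * L \<le> 1/2\<close> by (intro mult_right_mono) auto
      finally show "dist (apply_bcontfun (\<Phi> u) t) (apply_bcontfun (\<Phi> w) t) \<le> (1/2) * dist u w"
        using that P0 by (simp add: \<Phi> dist_norm)
    qed
  qed auto
  then obtain u where "u \<in> S" "\<Phi> u = u" by blast
  then have u: "apply_bcontfun u t = x + P u (cl t)" for t
    using \<Phi> by metis
  have "flow_on G T (apply_bcontfun u)"
    unfolding flow_on_def
  proof
    fix t assume t: "t \<in> {0..T}"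
    have "((\<lambda>t. x + P u t) has_vector_derivative G (apply_bcontfun u t)) (at t within {0..T})"
      using P[OF \<open>u \<in> S\<close> t] by (auto intro!: derivative_eq_intros)
    then show "(apply_bcontfun u has_vector_derivative G (apply_bcontfun u t)) (at t within {0..T})"
      by (rule has_vector_derivative_transform[OF t, rotated]) (use u cl in simp)
  qed
  moreover have "apply_bcontfun u 0 = x"
    using u[of 0] cl(2)[of 0] P0 \<open>u \<in> S\<close> \<open>0 < T\<close> by simp
  ultimately show ?thesis using that by blast
qed


text \<open>
A dissipative field is one whose negative is monotone. Its trajectories approach each other, hence
are unique, and their speed never exceeds the initial speed.
\<close>

context
  fixes G :: "'a::{real_inner, complete_space} \<Rightarrow> 'a"
  assumes dissipative: "\<And>x y. (G x - G y) \<bullet> (x - y) \<le> 0"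
begin

lemma dissipative_flow_contraction:
  assumes u: "flow_on G T u" and w: "flow_on G T w" and t: "t \<in> {0..T}"
  shows "norm (u t - w t) \<le> norm (u 0 - w 0)"
proof -
  have "flow_on G t u" "flow_on G t w"
    using u w t by (auto intro: flow_on_mono)
  then have "((\<lambda>r. u r - w r) has_vector_derivative G (u s) - G (w s)) (at s within {0..t})"
    if "s \<in> {0..t}" for s
    using that by (auto simp: flow_on_def intro!: has_vector_derivative_diff)
  then have "norm (u t - w t) \<le> norm (u 0 - w 0) + 0 * (t - 0)"
    by (rule norm_growth_of_radial_speed[rotated 2]) (use t dissipative in auto)
  then show ?thesis by simp
qed

lemma dissipative_flow_unique:
  assumes "flow_on G T u" "flow_on G T w" "u 0 = w 0" "t \<in> {0..T}"
  shows "u t = w t"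
  using dissipative_flow_contraction[OF assms(1,2,4)] assms(3) by simp

text \<open>
By dissipativity the radial velocity away from \<open>z\<close> is at most the one produced by the field at \<open>z\<close>
itself. Taking \<open>z\<close> to be the starting point bounds the initial displacement, and taking \<open>z\<close> to be a
zero of the field shows that the distance to \<open>z\<close> does not increase.
\<close>

lemma dissipative_flow_drift:
  assumes u: "flow_on G T u" and t: "t \<in> {0..T}"
  shows "norm (u t - z) \<le> norm (u 0 - z) + norm (G z) * t"
proof -
  have "flow_on G t u"
    using u t by (auto intro: flow_on_mono)
  then have "((\<lambda>r. u r - z) has_vector_derivative G (u s)) (at s within {0..t})"
    if "s \<in> {0..t}" for s
    using that by (auto simp: flow_on_def intro!: derivative_eq_intros)
  moreover have "G (u s) \<bullet> (u s - z) \<le> norm (G z) * norm (u s - z)" for s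
    using dissipative[of "u s" z] Cauchy_Schwarz_ineq2[of "G z" "u s - z"]
    by (simp add: inner_diff_left)
  ultimately have "norm (u t - z) \<le> norm (u 0 - z) + norm (G z) * (t - 0)"
    by (intro norm_growth_of_radial_speed[where w' = "\<lambda>s. G (u s)"]) (use t in auto)
  then show ?thesis by simp
qed

text \<open>
Both \<open>u\<close> and its time shift by \<open>t - s\<close> are trajectories, so their distance at time \<open>s\<close> is at most
their initial distance.
\<close>

lemma dissipative_flow_speed:
  assumes u: "flow_on G T u" and "0 \<le> s" "s \<le> t" "t \<le> T"
  shows "norm (u t - u s) \<le> norm (G (u 0)) * (t - s)"
proof -
  have "norm (u (s + (t - s)) - u s) \<le> norm (u (0 + (t - s)) - u 0)"
    using dissipative_flow_contraction[OF flow_on_shift[OF u, of "t - s"] flow_on_mono[OF u], of s] assms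
    by (simp add: add.commute)
  also have "\<dots> \<le> norm (G (u 0)) * (t - s)"
    using dissipative_flow_drift[OF u, of "t - s" "u 0"] assms by simp
  finally show ?thesis by simp
qed

text \<open>
If existence times were bounded, let \<open>Sup A\<close> be their supremum. Trajectories defined on longer and
longer intervals have a common Lipschitz constant, so their endpoints converge. Near the limit the
local existence time is bounded below, which allows one of them to be continued past \<open>Sup A\<close>. By
uniqueness the trajectories on the intervals \<open>{0..T}\<close> then glue to a trajectory on the half-line.
\<close>

theorem dissipative_flow_exists:
  assumes lip: "\<And>x. \<exists>r>0. \<exists>L. L-lipschitz_on (cball x r) G"
  obtains u where "u 0 = x" "\<And>t. t \<ge> 0 \<Longrightarrow> (u has_vector_derivative G (u t)) (at t within {0..})"
proof -
  have uniform: "\<exists>r>0. \<exists>e>0. \<forall>y\<in>cball l r. \<exists>u. u 0 = y \<and> flow_on G e u" for l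
  proof -
    obtain r L where "r > 0" and L: "L-lipschitz_on (cball l r) G" using lip by blast
    have "0 \<le> L" using L by (rule lipschitz_on_nonneg)
    define M where "M = norm (G l) + L * r"
    have M: "norm (G y) \<le> M" if "y \<in> cball l r" for y
    proof -
      have "norm (G y - G l) \<le> L * dist y l"
        using lipschitz_onD[OF L that, of l] \<open>r > 0\<close> by (simp add: dist_norm)
      also have "\<dots> \<le> L * r" using that \<open>0 \<le> L\<close> by (intro mult_left_mono) (auto simp: dist_commute)
      finally show ?thesis
        using norm_triangle_sub[of "G y" "G l"] by (simp add: M_def)
    qed
    have "0 \<le> M" using \<open>0 \<le> L\<close> \<open>r > 0\<close> by (simp add: M_def)
    \<comment> \<open>Points of the half-size ball keep distance \<open>r / 2\<close> from the boundary, so \<open>e * M \<le> r / 2\<close>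
      suffices; adding 1 to \<open>M\<close> and \<open>L\<close> avoids division by zero.\<close>
    define e where "e = min (r / 2 / (M + 1)) (1 / 2 / (L + 1))"
    have "e > 0" using \<open>0 \<le> L\<close> \<open>0 \<le> M\<close> \<open>r > 0\<close> by (simp add: e_def)
    have "e \<le> r / 2 / (M + 1)" "e \<le> 1 / 2 / (L + 1)"
      by (simp_all add: e_def)
    then have "e * (M + 1) \<le> r / 2" "e * (L + 1) \<le> 1 / 2"
      using \<open>0 \<le> M\<close> \<open>0 \<le> L\<close> pos_le_divide_eq[of "M + 1" e "r / 2"]
        pos_le_divide_eq[of "L + 1" e "1 / 2"] by linarith+
    then have eM: "e * M \<le> r / 2" and eL: "e * L \<le> 1 / 2"
      using \<open>e > 0\<close> by (auto simp: distrib_left)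
    have "\<exists>u. u 0 = y \<and> flow_on G e u" if y: "y \<in> cball l (r / 2)" for y
    proof -
      have sub: "cball y (r / 2) \<subseteq> cball l r"
      proof
        fix z assume "z \<in> cball y (r / 2)"
        then show "z \<in> cball l r" using y dist_triangle[of l z y] by auto
      qed
      obtain u where "u 0 = y" "flow_on G e u"
        by (rule local_flow_exists[of L y "r / 2" G M e])
          (use lipschitz_on_subset[OF L sub] M sub eM eL \<open>e > 0\<close> \<open>r > 0\<close> in auto)
      then show ?thesis by blast
    qed
    with \<open>e > 0\<close> \<open>r > 0\<close> show ?thesis by (intro exI[of _ "r / 2"]) auto
  qed
  define A where "A = {T. 0 \<le> T \<and> (\<exists>u. u 0 = x \<and> flow_on G T u)}"
  have down: "S \<in> A" if "T \<in> A" "0 \<le> S" "S \<le> T" for S T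
    using that flow_on_mono unfolding A_def by blast
  have "0 \<in> A"
  proof -
    obtain e u where "e > 0" "u 0 = x" "flow_on G e u"
      using uniform[of x] by force
    then show ?thesis unfolding A_def using flow_on_mono[of G e u 0] by auto
  qed
  have all: "T \<in> A" if "0 \<le> T" for T
  proof (rule ccontr)
    assume "T \<notin> A"
    then have ub: "S \<le> T" if "S \<in> A" for S
      using down[OF that \<open>0 \<le> T\<close>] by force
    then have bdd: "bdd_above A" by (intro bdd_aboveI[where M = T])
    have "\<exists>S. (\<forall>n::nat. S n \<in> A) \<and> S \<longlonglongrightarrow> Sup A"
      using closure_contains_Sup[OF _ bdd] \<open>0 \<in> A\<close> by (auto simp: closure_sequential)
    then obtain S where S: "\<And>n::nat. S n \<in> A" and lim: "S \<longlonglongrightarrow> Sup A" by blast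
    then have "\<forall>n. \<exists>u. u 0 = x \<and> flow_on G (S n) u" and S0: "\<And>n. 0 \<le> S n" by (auto simp: A_def)
    then obtain u where u0: "\<And>n. u n 0 = x" and u: "\<And>n. flow_on G (S n) (u n)" by metis
    have speed: "norm (u n (S n) - u m (S m)) \<le> norm (G x) * \<bar>S n - S m\<bar>" for n m
    proof -
      have *: "norm (u n (S n) - u m (S m)) \<le> norm (G x) * \<bar>S n - S m\<bar>" if "S m \<le> S n" for n m
      proof -
        have "u m (S m) = u n (S m)"
          using dissipative_flow_unique[OF u flow_on_mono[OF u that]] u0 S0 by auto
        then show ?thesis
          using dissipative_flow_speed[OF u[of n], of "S m" "S n"] that S0 u0 by simp
      qed
      show ?thesis
        using *[of m n] *[of n m] by (cases "S m \<le> S n") (auto simp: norm_minus_commute abs_minus_commute)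
    qed
    have "Cauchy (\<lambda>n. u n (S n))"
    proof (rule CauchyI)
      fix e :: real assume "e > 0"
      then have "e / (norm (G x) + 1) > 0"
        by (simp add: add_nonneg_pos)
      with LIMSEQ_imp_Cauchy[OF lim] obtain N
        where N: "\<And>m n. m \<ge> N \<Longrightarrow> n \<ge> N \<Longrightarrow> norm (S m - S n) < e / (norm (G x) + 1)"
        using CauchyD by blast
      have "norm (u m (S m) - u n (S n)) < e" if "m \<ge> N" "n \<ge> N" for m n
      proof -
        have "norm (u m (S m) - u n (S n)) \<le> (norm (G x) + 1) * \<bar>S m - S n\<bar>"
          using speed[of m n] by (simp add: algebra_simps)
        also have "\<dots> < e"
          using N[OF that] pos_less_divide_eq[of "norm (G x) + 1" "\<bar>S m - S n\<bar>" e]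
          by (simp add: add_nonneg_pos mult.commute)
        finally show ?thesis .
      qed
      then show "\<exists>M. \<forall>m\<ge>M. \<forall>n\<ge>M. norm (u m (S m) - u n (S n)) < e" by blast
    qed
    then obtain l where l: "(\<lambda>n. u n (S n)) \<longlonglongrightarrow> l"
      using Cauchy_convergent convergent_def by blast
    obtain r e where "r > 0" "e > 0"
      and re: "\<And>y. y \<in> cball l r \<Longrightarrow> \<exists>w. w 0 = y \<and> flow_on G e w"
      using uniform[of l] by blast
    have "eventually (\<lambda>n. dist (u n (S n)) l < r \<and> dist (S n) (Sup A) < e) sequentially"
      using tendstoD[OF l \<open>r > 0\<close>] tendstoD[OF lim \<open>e > 0\<close>] by (rule eventually_conj)
    then obtain n where n: "dist (u n (S n)) l < r" "dist (S n) (Sup A) < e"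
      by (auto simp: eventually_sequentially)
    then obtain w where "w 0 = u n (S n)" "flow_on G e w"
      using re[of "u n (S n)"] by (auto simp: dist_commute)
    then have "S n + e \<in> A"
      unfolding A_def using flow_on_concat[OF u[of n], of e w] S0[of n] u0[of n] \<open>e > 0\<close>
      by (auto intro!: exI[of _ "\<lambda>t. if t \<in> {0..S n} then u n t else w (t - S n)"])
    then have "S n + e \<le> Sup A" using bdd by (rule cSup_upper)
    with n(2) show False by (simp add: dist_real_def)
  qed
  then have "\<forall>T\<ge>0. \<exists>u. u 0 = x \<and> flow_on G T u" by (auto simp: A_def)
  then obtain U where U0: "\<And>T. T \<ge> 0 \<Longrightarrow> U T 0 = x" and U: "\<And>T. T \<ge> 0 \<Longrightarrow> flow_on G T (U T)"
    by metis
  \<comment> \<open>Looking one time unit ahead keeps \<open>t\<close> inside the interval on which \<open>U (t + 1)\<close> is a trajectory.\<close>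
  define u where "u t = U (t + 1) t" for t
  have agree: "u s = U T s" if "0 \<le> s" "s \<le> T" for s T
  proof (cases "s + 1 \<le> T")
    case True
    then show ?thesis unfolding u_def
      using dissipative_flow_unique[OF U flow_on_mono[OF U True], of s] U0 that by auto
  next
    case False
    then have "U T s = U (s + 1) s"
      using dissipative_flow_unique[OF U[of T] flow_on_mono[OF U[of "s + 1"]], of s] U0 that by auto
    then show ?thesis by (simp add: u_def)
  qed
  have "(u has_vector_derivative G (u t)) (at t within {0..})" if "t \<ge> 0" for t
  proof -
    have "(U (t + 1) has_vector_derivative G (U (t + 1) t)) (at t within {0..t + 1})"
      using U[of "t + 1"] that by (simp add: flow_on_def)
    then have "(u has_vector_derivative G (u t)) (at t within {0..t + 1})"
      using agree[of _ "t + 1"] that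
      by (intro has_vector_derivative_transform[of t "{0..t + 1}" u "U (t + 1)"]) auto
    moreover have "at t within {0..t + 1} = at t within {0..}"
      by (rule at_within_nhd[of t "{..<t + 1}"]) (use that in auto)
    ultimately show ?thesis by simp
  qed
  moreover have "u 0 = x" using U0 by (simp add: u_def)
  ultimately show ?thesis using that by blast
qed

end

section \<open>Gradients of convex functions of class C2\<close>

lemma grad_eqI:
  assumes "(f has_derivative (\<lambda>h. r \<bullet> h)) (at x)"
  shows "grad f x = r"
  unfolding grad_def
proof (rule the_equality)
  show "GDERIV f x :> r" using assms by (simp add: gderiv_def inner_commute)
  fix s assume "GDERIV f x :> s"
  then have "(\<lambda>h. r \<bullet> h) = (\<lambda>h. h \<bullet> s)"
    unfolding gderiv_def using assms by (rule has_derivative_unique[symmetric])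
  then have "(r - s) \<bullet> (r - s) = 0"
    by (metis inner_commute inner_diff_left right_minus_eq)
  then show "s = r" by simp
qed

text \<open>
The second difference of \<open>f\<close> over the parallelogram spanned by \<open>s *\<^sub>R h\<close> and \<open>s *\<^sub>R k\<close> is symmetric in
\<open>h\<close> and \<open>k\<close>. The mean value theorem along \<open>h\<close> and differentiability of the gradient at \<open>x\<close> show
that it equals \<open>s ^ 2 * (A k \<bullet> h)\<close> up to an error of order \<open>o(s ^ 2)\<close>; exchanging the roles of
\<open>h\<close> and \<open>k\<close> identifies the two limits.
\<close>

lemma second_derivative_symmetric:
  fixes f :: "'a::real_inner \<Rightarrow> real"
  assumes grad: "\<And>y. (f has_derivative (\<lambda>h. g y \<bullet> h)) (at y)"
    and hess: "(g has_derivative A) (at x)"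
  shows "A h \<bullet> k = A k \<bullet> h"
proof -
  interpret A: bounded_linear A using hess by (rule has_derivative_bounded_linear)
  define N where "N = norm h + norm k"
  have "\<bar>A h \<bullet> k - A k \<bullet> h\<bar> \<le> 0 + e" if "e > 0" for e
  proof -
    \<comment> \<open>Each of the two quotients contributes an error \<open>2 * c * N ^ 2\<close>; \<open>N ^ 2 + 1\<close> avoids
      division by zero.\<close>
    define c where "c = e / (4 * (N\<^sup>2 + 1))"
    have "c > 0" using \<open>e > 0\<close> by (simp add: c_def add_nonneg_pos)
    then obtain d where "d > 0"
      and d: "\<And>y. norm (y - x) < d \<Longrightarrow> norm (g y - g x - A (y - x)) \<le> c * norm (y - x)"
      using hess unfolding has_derivative_at_alt by blast
    define s where "s = d / (N + 1)"
    have "0 \<le> N" by (simp add: N_def)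
    then have "s > 0" using \<open>d > 0\<close> by (simp add: s_def add_nonneg_pos)
    have "s * (N + 1) = d" using \<open>0 \<le> N\<close> by (simp add: s_def)
    then have sN: "s * N < d" using \<open>s > 0\<close> by (simp add: distrib_left)
    have rem: "norm (g y - g x - A (y - x)) \<le> c * (s * N)" if "norm (y - x) \<le> s * N" for y
      using d[of y] that sN mult_left_mono[OF that, of c] \<open>c > 0\<close> by linarith
    have quotient: "\<bar>f (x + s *\<^sub>R a + s *\<^sub>R b) - f (x + s *\<^sub>R a) - f (x + s *\<^sub>R b) + f x - s\<^sup>2 * (A b \<bullet> a)\<bar>
        \<le> 2 * c * s\<^sup>2 * N\<^sup>2" if ab: "norm a + norm b = N" for a b
    proof -
      let ?q = "\<lambda>t. f (x + t *\<^sub>R (s *\<^sub>R a) + s *\<^sub>R b) - f (x + t *\<^sub>R (s *\<^sub>R a))"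
      let ?q' = "\<lambda>t. (g (x + t *\<^sub>R (s *\<^sub>R a) + s *\<^sub>R b) - g (x + t *\<^sub>R (s *\<^sub>R a))) \<bullet> (s *\<^sub>R a)"
      have line: "((\<lambda>t. f (y + t *\<^sub>R (s *\<^sub>R a) )) has_real_derivative g (y + t *\<^sub>R (s *\<^sub>R a)) \<bullet> (s *\<^sub>R a)) (at t)"
        for y t
        unfolding has_field_derivative_def
        by (rule has_derivative_eq_rhs, rule has_derivative_compose[OF _ grad])
          (auto intro!: derivative_eq_intros)
      have "(?q has_real_derivative ?q' t) (at t)" for t
        using DERIV_diff[OF line[of "x + s *\<^sub>R b" t] line[of x t]]
        by (simp add: inner_diff_left right_diff_distrib add_ac)
      then obtain t where t: "0 < t" "t < 1" "?q 1 - ?q 0 = (1 - 0) * ?q' t"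
        using MVT2[of 0 1 ?q ?q'] by auto
      define y where "y = x + t *\<^sub>R (s *\<^sub>R a)"
      have "norm (y - x) = t * s * norm a"
        using t \<open>s > 0\<close> by (simp add: y_def abs_mult)
      also have "\<dots> \<le> 1 * s * norm a" using t \<open>s > 0\<close> by (intro mult_right_mono) auto
      finally have y: "norm (y - x) \<le> s * norm a" by simp
      have "norm (y + s *\<^sub>R b - x) \<le> norm (y - x) + norm (s *\<^sub>R b)"
        using norm_triangle_ineq[of "y - x" "s *\<^sub>R b"] by (simp add: algebra_simps)
      then have yb: "norm (y + s *\<^sub>R b - x) \<le> s * N"
        using y \<open>s > 0\<close> unfolding ab[symmetric] by (simp add: distrib_left)
      have ya: "norm (y - x) \<le> s * N"
        using y \<open>s > 0\<close> unfolding ab[symmetric] by (simp add: distrib_left add_increasing2)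
      define r where "r z = g z - g x - A (z - x)" for z
      have "g (y + s *\<^sub>R b) - g y = s *\<^sub>R A b + (r (y + s *\<^sub>R b) - r y)"
        by (simp add: r_def A.diff A.add A.scaleR algebra_simps)
      then have "(g (y + s *\<^sub>R b) - g y) \<bullet> (s *\<^sub>R a) - s\<^sup>2 * (A b \<bullet> a)
          = (r (y + s *\<^sub>R b) - r y) \<bullet> (s *\<^sub>R a)"
        by (simp add: inner_add_left power2_eq_square distrib_left)
      moreover have "norm (r (y + s *\<^sub>R b) - r y) \<le> 2 * c * s * N"
        using rem[OF yb] rem[OF ya] norm_triangle_ineq4[of "r (y + s *\<^sub>R b)" "r y"]
        by (simp add: r_def)
      ultimately have "\<bar>(g (y + s *\<^sub>R b) - g y) \<bullet> (s *\<^sub>R a) - s\<^sup>2 * (A b \<bullet> a)\<bar>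
          \<le> norm (r (y + s *\<^sub>R b) - r y) * norm (s *\<^sub>R a)"
        using Cauchy_Schwarz_ineq2[of "r (y + s *\<^sub>R b) - r y" "s *\<^sub>R a"]
        by simp
      also have "\<dots> \<le> (2 * c * s * N) * (s * N)"
        using \<open>norm (r (y + s *\<^sub>R b) - r y) \<le> 2 * c * s * N\<close> \<open>s > 0\<close> \<open>c > 0\<close> \<open>0 \<le> N\<close> ab
        by (intro mult_mono) (auto intro: mult_left_mono)
      also have "\<dots> = 2 * c * s\<^sup>2 * N\<^sup>2" by (simp add: power2_eq_square)
      finally show ?thesis using t(3) by (simp add: y_def algebra_simps)
    qed
    have "s\<^sup>2 * \<bar>A h \<bullet> k - A k \<bullet> h\<bar> = \<bar>s\<^sup>2 * (A h \<bullet> k) - s\<^sup>2 * (A k \<bullet> h)\<bar>"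
      by (simp add: abs_mult flip: right_diff_distrib)
    also have "\<dots> \<le> 4 * c * s\<^sup>2 * N\<^sup>2"
      using quotient[of h k] quotient[of k h] by (simp add: N_def add_ac)
    also have "\<dots> = s\<^sup>2 * (4 * c * N\<^sup>2)" by simp
    finally have "\<bar>A h \<bullet> k - A k \<bullet> h\<bar> \<le> 4 * c * N\<^sup>2"
      using \<open>s > 0\<close> by simp
    also have "\<dots> \<le> 4 * c * (N\<^sup>2 + 1)" using \<open>c > 0\<close> by simp
    also have "\<dots> = e"
    proof -
      have "N\<^sup>2 + 1 \<noteq> 0" using zero_le_power2[of N] by linarith
      then show ?thesis by (simp add: c_def field_simps)
    qed
    finally show ?thesis by simp
  qed
  then have "\<bar>A h \<bullet> k - A k \<bullet> h\<bar> \<le> 0" by (rule field_le_epsilon)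
  then show ?thesis by simp
qed

text \<open>
The Riesz isomorphism \<open>R\<close> is bounded and linear, so composing with it turns the derivatives with
values in the dual space into a gradient with a continuous derivative \<open>A\<close> on the space itself.
\<close>

lemma class_C2_gradient:
  fixes f :: "'a::{real_inner, complete_space} \<Rightarrow> real"
  assumes "class_C2 f"
  obtains A :: "'a \<Rightarrow> 'a \<Rightarrow>\<^sub>L 'a"
  where "\<And>x. (f has_derivative (\<lambda>h. grad f x \<bullet> h)) (at x)"
    and "\<And>x. (grad f has_derivative blinfun_apply (A x)) (at x)"
    and "continuous_on UNIV A"
    and "\<And>x h k. A x h \<bullet> k = A x k \<bullet> h"
proof -
  obtain f' :: "'a \<Rightarrow> 'a \<Rightarrow>\<^sub>L real" and f'' :: "'a \<Rightarrow> 'a \<Rightarrow>\<^sub>L ('a \<Rightarrow>\<^sub>L real)"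
    where f': "\<And>x. (f has_derivative blinfun_apply (f' x)) (at x)"
      and f'': "\<And>x. (f' has_derivative blinfun_apply (f'' x)) (at x)"
      and cont: "continuous_on UNIV f''"
    using assms unfolding class_C2_def by blast
  have "\<exists>r. \<forall>h. blinfun_apply l h = r \<bullet> h" for l :: "'a \<Rightarrow>\<^sub>L real"
    using Riesz_representation[OF blinfun.bounded_linear_right] by metis
  then obtain R :: "('a \<Rightarrow>\<^sub>L real) \<Rightarrow> 'a" where R: "\<And>l h. blinfun_apply l h = R l \<bullet> h"
    by metis
  have R_eqI: "R l = r" if "\<And>h. blinfun_apply l h = r \<bullet> h" for l r
  proof -
    have "(R l - r) \<bullet> (R l - r) = 0"
      using that[of "R l - r"] R[of l "R l - r"] by (simp add: inner_diff_left)
    then show ?thesis by simp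
  qed
  have "bounded_linear R"
  proof (rule bounded_linear_intro)
    show "R (l + m) = R l + R m" for l m
      by (rule R_eqI) (simp add: blinfun.add_left inner_add_left flip: R)
    show "R (c *\<^sub>R l) = c *\<^sub>R R l" for c l
      by (rule R_eqI) (simp add: blinfun.scaleR_left flip: R)
    show "norm (R l) \<le> norm l * 1" for l
    proof (rule norm_le_if_inner_le)
      show "R l \<bullet> h \<le> norm l * 1 * norm h" for h
        using norm_blinfun[of l h] by (simp add: R)
    qed simp
  qed
  note R_lin = this
  have grad: "grad f x = R (f' x)" for x
    by (rule grad_eqI, rule has_derivative_eq_rhs[OF f']) (simp add: R fun_eq_iff)
  define A where "A x = Blinfun R o\<^sub>L f'' x" for x
  have A: "blinfun_apply (A x) h = R (f'' x h)" for x h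
    by (simp add: A_def bounded_linear_Blinfun_apply[OF R_lin])
  have D: "(f has_derivative (\<lambda>h. grad f x \<bullet> h)) (at x)" for x
    by (rule has_derivative_eq_rhs[OF f']) (simp add: R grad fun_eq_iff)
  have D2: "(grad f has_derivative blinfun_apply (A x)) (at x)" for x
    using bounded_linear.has_derivative[OF R_lin f''[of x]]
    by (simp add: grad[abs_def] A[abs_def])
  show ?thesis
  proof (rule that[OF D D2])
    show "continuous_on UNIV A"
      unfolding A_def by (intro continuous_intros cont)
    show "A x h \<bullet> k = A x k \<bullet> h" for x h k
      by (rule second_derivative_symmetric[OF D D2])
  qed
qed

lemma locally_lipschitz_of_continuous_derivative:
  fixes g :: "'a::real_normed_vector \<Rightarrow> 'b::real_normed_vector"
  assumes der: "\<And>x. (g has_derivative blinfun_apply (A x)) (at x)" and cont: "continuous_on UNIV A"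
  shows "\<exists>r>0. \<exists>L. L-lipschitz_on (cball x r) g"
proof -
  obtain d where "d > 0" and d: "\<And>y. dist y x < d \<Longrightarrow> dist (A y) (A x) < 1"
    using cont unfolding continuous_on_iff by (metis UNIV_I zero_less_one)
  have "(norm (A x) + 1)-lipschitz_on (cball x (d / 2)) g"
  proof (rule lipschitz_onI)
    fix y z assume yz: "y \<in> cball x (d / 2)" "z \<in> cball x (d / 2)"
    have "onorm (blinfun_apply (A w)) \<le> norm (A x) + 1" if "w \<in> cball x (d / 2)" for w
      using d[of w] that \<open>d > 0\<close> norm_triangle_sub[of "A w" "A x"]
      by (auto simp: norm_blinfun.rep_eq[symmetric] dist_norm norm_minus_commute)
    then show "dist (g y) (g z) \<le> (norm (A x) + 1) * dist y z"
      unfolding dist_norm using yz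
      by (intro differentiable_bound[of "cball x (d / 2)" g "\<lambda>w. blinfun_apply (A w)"])
        (auto intro: has_derivative_at_withinI der)
  qed simp
  with \<open>d > 0\<close> show ?thesis by (intro exI[of _ "d / 2"]) auto
qed

text \<open>
If the tangent at \<open>x\<close> exceeded \<open>f\<close> at \<open>y\<close>, then \<open>f\<close> would start off from \<open>x\<close> towards \<open>y\<close> with a
slope larger than that of the chord, against convexity.
\<close>

lemma convex_above_tangent:
  fixes f :: "'a::real_inner \<Rightarrow> real"
  assumes conv: "convex_on UNIV f" and der: "(f has_derivative (\<lambda>h. g \<bullet> h)) (at x)"
  shows "f x + g \<bullet> (y - x) \<le> f y"
proof (rule ccontr)
  assume "\<not> ?thesis"
  then have pos: "g \<bullet> (y - x) - (f y - f x) > 0" by simp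
  let ?q = "\<lambda>t. f (x + t *\<^sub>R (y - x)) - t * (f y - f x)"
  have "((\<lambda>t. f (x + t *\<^sub>R (y - x))) has_derivative (\<lambda>t. g \<bullet> (t *\<^sub>R (y - x)))) (at 0)"
    by (rule has_derivative_compose[where g = f]) (auto intro!: derivative_eq_intros der)
  then have "((\<lambda>t. f (x + t *\<^sub>R (y - x))) has_real_derivative g \<bullet> (y - x)) (at 0)"
    by (simp add: has_field_derivative_def mult_commute_abs)
  then have "(?q has_real_derivative g \<bullet> (y - x) - (f y - f x)) (at 0)"
    by (auto intro!: derivative_eq_intros)
  then obtain d where "d > 0" and d: "\<And>h. h > 0 \<Longrightarrow> h < d \<Longrightarrow> ?q 0 < ?q (0 + h)"
    using DERIV_pos_inc_right[OF _ pos] by blast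
  define t where "t = min 1 (d / 2)"
  have t: "0 < t" "t < d" "t \<le> 1" using \<open>d > 0\<close> by (auto simp: t_def)
  have "x + t *\<^sub>R (y - x) = (1 - t) *\<^sub>R x + t *\<^sub>R y" by (simp add: algebra_simps)
  then have "f (x + t *\<^sub>R (y - x)) \<le> (1 - t) * f x + t * f y"
    using convex_onD[OF conv, of t x y] t by simp
  with d[of t] t show False by (simp add: algebra_simps)
qed

lemma convex_gradient_monotone:
  fixes f :: "'a::real_inner \<Rightarrow> real"
  assumes conv: "convex_on UNIV f" and der: "\<And>x. (f has_derivative (\<lambda>h. g x \<bullet> h)) (at x)"
  shows "0 \<le> (g x - g y) \<bullet> (x - y)"
  using convex_above_tangent[OF conv der, of x y] convex_above_tangent[OF conv der, of y x]
  by (simp add: inner_diff_left inner_diff_right)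

lemma monotone_derivative_nonneg:
  fixes g :: "'a::real_inner \<Rightarrow> 'a"
  assumes mono: "\<And>x y. 0 \<le> (g x - g y) \<bullet> (x - y)" and der: "(g has_derivative A) (at x)"
  shows "0 \<le> A h \<bullet> h"
proof (rule ccontr)
  assume "\<not> 0 \<le> A h \<bullet> h"
  then have neg: "A h \<bullet> h < 0" by simp
  interpret A: bounded_linear A using der by (rule has_derivative_bounded_linear)
  have "((\<lambda>t. g (x + t *\<^sub>R h)) has_derivative (\<lambda>t. A (t *\<^sub>R h))) (at 0)"
    by (rule has_derivative_compose[where g = g]) (auto intro!: derivative_eq_intros der)
  then have "((\<lambda>t. g (x + t *\<^sub>R h)) has_vector_derivative A h) (at 0)"
    by (simp add: has_vector_derivative_def A.scaleR)
  from has_vector_derivative_diff[OF this has_vector_derivative_const[of "g x"]]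
  have "((\<lambda>t. (g (x + t *\<^sub>R h) - g x) \<bullet> h) has_vector_derivative A h \<bullet> h) (at 0)"
    using bounded_linear.has_vector_derivative[OF bounded_linear_inner_left] by fastforce
  then obtain d where "d > 0"
    and d: "\<And>t. t > 0 \<Longrightarrow> t < d \<Longrightarrow> (g (x + t *\<^sub>R h) - g x) \<bullet> h < 0"
    using DERIV_neg_dec_right[OF _ neg, of "\<lambda>t. (g (x + t *\<^sub>R h) - g x) \<bullet> h" 0]
    by (auto simp: has_real_derivative_iff_has_vector_derivative)
  then have "(g (x + (d / 2) *\<^sub>R h) - g x) \<bullet> h < 0" by simp
  moreover have "0 \<le> (d / 2) * ((g (x + (d / 2) *\<^sub>R h) - g x) \<bullet> h)"
    using mono[of "x + (d / 2) *\<^sub>R h" x] by simp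
  ultimately show False using \<open>d > 0\<close> by (simp add: zero_le_mult_iff)
qed

text \<open>
Symmetry of the Hessian enters here: the chain rule gives the adjoint of \<open>A\<close> applied to \<open>g x\<close>.
\<close>

lemma grad_half_norm_sq:
  fixes g :: "'a::real_inner \<Rightarrow> 'a"
  assumes der: "(g has_derivative A) (at x)" and sym: "\<And>h k. A h \<bullet> k = A k \<bullet> h"
  shows "grad (\<lambda>x. (1/2) * (norm (g x))\<^sup>2) x = A (g x)"
proof (rule grad_eqI)
  have "((\<lambda>x. (1/2) * (g x \<bullet> g x)) has_derivative (\<lambda>h. (1/2) * (g x \<bullet> A h + A h \<bullet> g x))) (at x)"
    by (intro derivative_intros der)
  then show "((\<lambda>x. (1/2) * (norm (g x))\<^sup>2) has_derivative (\<lambda>h. A (g x) \<bullet> h)) (at x)"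
    by (simp add: power2_norm_eq_inner inner_commute[of "g x"] sym[of _ "g x"])
qed

section \<open>Asymptotic centers\<close>

text \<open>
The center \<open>c\<close> minimizes \<open>\<phi> y\<close>, the upper limit of \<open>norm (u t - y) ^ 2\<close> as \<open>t\<close> grows. The
parallelogram law for \<open>u t\<close>, \<open>x\<close>, \<open>y\<close> passes to the upper limit and makes \<open>\<phi>\<close> strongly midpoint
convex, so the minimizer exists and is unique. The conclusion is uniqueness in the form in which it
is applied: a point that is asymptotically no farther from \<open>u\<close> than \<open>c\<close> must be \<open>c\<close>.
\<close>

lemma asymptotic_center:
  fixes u :: "real \<Rightarrow> 'a::{real_inner, complete_space}"
  assumes bdd: "bounded (u ` {0..})"
  obtains c where "\<And>y. (\<And>r. \<forall>\<^sub>F t in at_top. norm (u t - c) \<le> r \<Longrightarrow> \<forall>\<^sub>F t in at_top. norm (u t - y) \<le> r)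
    \<Longrightarrow> y = c"
proof -
  obtain K where K: "\<And>t. t \<ge> 0 \<Longrightarrow> norm (u t) \<le> K"
    using bdd by (force simp: bounded_iff)
  define R where "R y = {r. \<forall>\<^sub>F t in at_top. (norm (u t - y))\<^sup>2 \<le> r}" for y
  have R_mono: "s \<in> R y" if "r \<in> R y" "r \<le> s" for r s y
    using that unfolding R_def by (auto elim!: eventually_mono)
  have R_nonneg: "0 \<le> r" if "r \<in> R y" for r y
  proof -
    have "\<forall>\<^sub>F t::real in at_top. 0 \<le> r"
      by (rule eventually_mono[OF that[unfolded R_def, simplified]])
        (rule order_trans[OF zero_le_power2])
    then show ?thesis by simp
  qed
  have dist_sum: "norm (u t - x) + norm (u t - y) \<le> 2 * K + norm x + norm y" if "t \<ge> 0" for t x y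
    using norm_triangle_ineq4[of "u t" x] norm_triangle_ineq4[of "u t" y] K[OF that] by linarith
  have "R y \<noteq> {}" for y
  proof -
    have "\<forall>\<^sub>F t in at_top. (norm (u t - y))\<^sup>2 \<le> (K + norm y)\<^sup>2"
      using eventually_ge_at_top[of 0]
    proof eventually_elim
      case (elim t)
      then show ?case using dist_sum[of t y y] by (intro power_mono) auto
    qed
    then show ?thesis by (auto simp: R_def)
  qed
  note R_ne = this
  have R_bdd: "bdd_below (R y)" for y
    by (rule bdd_belowI[where m = 0]) (rule R_nonneg)
  define \<phi> where "\<phi> y = Inf (R y)" for y
  have \<phi>_le: "\<phi> y \<le> r" if "r \<in> R y" for r y
    unfolding \<phi>_def using that R_bdd by (rule cInf_lower)
  have \<phi>_approx: "\<phi> y + e \<in> R y" if "e > 0" for e y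
  proof -
    obtain r where "r \<in> R y" "r < \<phi> y + e"
      using cInf_lessD[OF R_ne, of y "\<phi> y + e"] \<open>e > 0\<close> unfolding \<phi>_def by auto
    then show ?thesis using R_mono by (meson less_imp_le)
  qed
  have mid: "\<phi> ((1/2) *\<^sub>R (x + y)) \<le> (\<phi> x + \<phi> y) / 2 - (1/4) * (norm (x - y))\<^sup>2" for x y
  proof (rule field_le_epsilon)
    fix e :: real assume "e > 0"
    have "\<forall>\<^sub>F t in at_top. (norm (u t - x))\<^sup>2 \<le> \<phi> x + e" "\<forall>\<^sub>F t in at_top. (norm (u t - y))\<^sup>2 \<le> \<phi> y + e"
      using \<phi>_approx[OF \<open>e > 0\<close>] by (auto simp: R_def)
    then have "\<forall>\<^sub>F t in at_top. (norm (u t - (1/2) *\<^sub>R (x + y)))\<^sup>2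
        \<le> (\<phi> x + \<phi> y) / 2 - (1/4) * (norm (x - y))\<^sup>2 + e"
    proof eventually_elim
      case (elim t)
      then show ?case unfolding norm_midpoint_sq by argo
    qed
    then show "\<phi> ((1/2) *\<^sub>R (x + y)) \<le> (\<phi> x + \<phi> y) / 2 - (1/4) * (norm (x - y))\<^sup>2 + e"
      by (intro \<phi>_le) (simp add: R_def)
  qed
  have \<phi>_diff: "\<phi> x \<le> \<phi> y + norm (x - y) * (2 * K + norm x + norm y)" for x y
  proof (rule field_le_epsilon)
    fix e :: real assume "e > 0"
    have "\<forall>\<^sub>F t in at_top. (norm (u t - y))\<^sup>2 \<le> \<phi> y + e"
      using \<phi>_approx[OF \<open>e > 0\<close>] by (auto simp: R_def)
    then have "\<forall>\<^sub>F t in at_top. (norm (u t - x))\<^sup>2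
        \<le> \<phi> y + norm (x - y) * (2 * K + norm x + norm y) + e"
      using eventually_ge_at_top[of 0]
    proof eventually_elim
      case (elim t)
      have "(norm (u t - x))\<^sup>2 - (norm (u t - y))\<^sup>2
          = (norm (u t - x) - norm (u t - y)) * (norm (u t - x) + norm (u t - y))"
        by (simp add: power2_eq_square algebra_simps)
      also have "\<dots> \<le> norm (x - y) * (2 * K + norm x + norm y)"
      proof (rule mult_mono)
        show "norm (u t - x) - norm (u t - y) \<le> norm (x - y)"
          using norm_triangle_ineq2[of "u t - x" "u t - y"] by (simp add: norm_minus_commute)
        show "norm (u t - x) + norm (u t - y) \<le> 2 * K + norm x + norm y"
          using dist_sum elim by blast
      qed auto
      finally show ?case using elim by linarith
    qed
    then show "\<phi> x \<le> \<phi> y + norm (x - y) * (2 * K + norm x + norm y) + e"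
      by (intro \<phi>_le) (simp add: R_def)
  qed
  have cont: "continuous_on UNIV \<phi>"
    unfolding continuous_on_def
  proof
    fix x :: 'a
    have "((\<lambda>y. norm (y - x) * (2 * K + norm y + norm x)) \<longlongrightarrow> norm (x - x) * (2 * K + norm x + norm x)) (at x)"
      by (intro tendsto_intros)
    then have lim: "((\<lambda>y. norm (y - x) * (2 * K + norm y + norm x)) \<longlongrightarrow> 0) (at x)" by simp
    have "norm (\<phi> y - \<phi> x) \<le> norm (y - x) * (2 * K + norm y + norm x)" for y
      using \<phi>_diff[of x y] \<phi>_diff[of y x] by (simp add: norm_minus_commute add_ac abs_le_iff)
    then have "((\<lambda>y. \<phi> y - \<phi> x) \<longlongrightarrow> 0) (at x)"
      by (intro Lim_null_comparison[OF _ lim] always_eventually) blast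
    then show "(\<phi> \<longlongrightarrow> \<phi> x) (at x within UNIV)" by (simp add: Lim_null[symmetric])
  qed
  have "0 \<le> \<phi> y" for y
    unfolding \<phi>_def using R_ne R_nonneg by (rule cInf_greatest)
  then have bdd_\<phi>: "bdd_below (range \<phi>)" by (intro bdd_belowI[where m = 0]) auto
  have "\<exists>c. \<forall>y. \<phi> y \<le> \<phi> c \<longrightarrow> y = c"
    by (rule strongly_midconvex_attains_unique_minimum[OF _ mid cont bdd_\<phi>]) auto
  then obtain c where c: "\<And>y. \<phi> y \<le> \<phi> c \<Longrightarrow> y = c" by blast
  have "y = c" if *: "\<And>r. \<forall>\<^sub>F t in at_top. norm (u t - c) \<le> r \<Longrightarrow> \<forall>\<^sub>F t in at_top. norm (u t - y) \<le> r" for y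
  proof (rule c, rule field_le_epsilon)
    fix e :: real assume "e > 0"
    note e = \<phi>_approx[OF \<open>e > 0\<close>, of c]
    then have "\<forall>\<^sub>F t in at_top. norm (u t - c) \<le> sqrt (\<phi> c + e)"
      unfolding R_def by (auto elim!: eventually_mono simp: real_le_rsqrt)
    then have "\<forall>\<^sub>F t in at_top. norm (u t - y) \<le> sqrt (\<phi> c + e)" by (rule *)
    then have "\<forall>\<^sub>F t in at_top. (norm (u t - y))\<^sup>2 \<le> \<phi> c + e"
      using R_nonneg[OF e] by (auto elim!: eventually_mono dest: power_mono[where n = 2])
    then show "\<phi> y \<le> \<phi> c + e" by (intro \<phi>_le) (simp add: R_def)
  qed
  then show ?thesis using that by blast
qed

section \<open>Trajectories on the half-line\<close>

text \<open>
A primitive of a nonnegative function increases, and its increments are the integrals over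
\<open>{0..T}\<close>; monotone convergence passes to the half-line.
\<close>

lemma nn_integral_halfline_finite_iff:
  fixes f F :: "real \<Rightarrow> real"
  assumes der: "\<And>t. t \<ge> 0 \<Longrightarrow> (F has_real_derivative f t) (at t within {0..})"
    and cont: "continuous_on {0..} f" and nonneg: "\<And>t. t \<ge> 0 \<Longrightarrow> 0 \<le> f t"
  shows "(\<integral>\<^sup>+t\<in>{0..}. ennreal (f t) \<partial>lborel) < \<infinity> \<longleftrightarrow> bdd_above (F ` {0..})"
proof -
  define h where "h T t = ennreal (indicator {0..T} t *\<^sub>R f t)" for T t :: real
  have h_eq: "h T t = ennreal (f t) * indicator {0..T} t" for T t
    by (auto simp: h_def indicator_def)
  have cont': "continuous_on {0..T} f" for T
    using cont by (rule continuous_on_subset) auto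
  have h_int: "(\<integral>\<^sup>+t. h T t \<partial>lborel) = ennreal (F T - F 0)" if "T \<ge> 0" for T
  proof -
    have "has_bochner_integral lborel (\<lambda>t. indicator {0..T} t *\<^sub>R f t) (F T - F 0)"
      by (rule has_bochner_integral_FTC_Icc[OF that _ cont'])
        (auto simp flip: has_real_derivative_iff_has_vector_derivative intro: DERIV_subset[OF der])
    then show ?thesis
      unfolding h_def by (subst nn_integral_eq_integral)
        (auto simp: has_bochner_integral_iff indicator_def nonneg intro!: AE_I2)
  qed
  have F_mono: "F 0 \<le> F T" if "T \<ge> 0" for T
  proof -
    have "- F T \<le> - F 0"
      by (rule antimono_of_derivative_nonpos[OF that, where f' = "\<lambda>t. - f t"])
        (auto intro!: DERIV_minus DERIV_subset[OF der] nonneg)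
    then show ?thesis by simp
  qed
  let ?I = "\<integral>\<^sup>+t\<in>{0..}. ennreal (f t) \<partial>lborel"
  show ?thesis
  proof
    assume fin: "?I < \<infinity>"
    have "F T \<le> F 0 + enn2real ?I" if "T \<ge> 0" for T
    proof -
      have "ennreal (F T - F 0) \<le> ?I"
        unfolding h_int[OF that, symmetric]
        by (rule nn_integral_mono) (auto simp: h_eq indicator_def)
      then have "F T - F 0 \<le> enn2real ?I"
        using fin F_mono[OF that] enn2real_mono[of "ennreal (F T - F 0)" ?I] by simp
      then show ?thesis by simp
    qed
    then show "bdd_above (F ` {0..})" by (auto intro!: bdd_aboveI)
  next
    assume "bdd_above (F ` {0..})"
    then obtain B where B: "\<And>T. T \<ge> 0 \<Longrightarrow> F T \<le> B" by (auto simp: bdd_above_def)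
    have "(\<lambda>n. \<integral>\<^sup>+t. h (real n) t \<partial>lborel) \<longlonglongrightarrow> ?I"
    proof (rule nn_integral_LIMSEQ)
      show "incseq (\<lambda>n. h (real n))"
        by (auto simp: incseq_def le_fun_def h_eq indicator_def)
      show "h (real n) \<in> borel_measurable lborel" for n
        unfolding h_def using borel_measurable_continuous_on_indicator[OF _ cont', of "real n"]
        by simp
      show "(\<lambda>n. h (real n) t) \<longlonglongrightarrow> ennreal (f t) * indicator {0..} t" for t
      proof (rule tendsto_eventually)
        obtain N :: nat where "t \<le> real N" using real_arch_simple by blast
        then have "h (real n) t = ennreal (f t) * indicator {0..} t" if "n \<ge> N" for n
          using that by (auto simp: h_eq indicator_def)
        then show "\<forall>\<^sub>F n in sequentially. h (real n) t = ennreal (f t) * indicator {0..} t"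
          by (auto simp: eventually_sequentially)
      qed
    qed
    then have "?I \<le> ennreal (B - F 0)"
      by (rule LIMSEQ_le_const2) (use B in \<open>auto simp: h_int intro!: ennreal_leI\<close>)
    then show "?I < \<infinity>" by (rule le_less_trans) simp
  qed
qed

lemma tderiv_eqI:
  assumes "t \<ge> 0" "(v has_vector_derivative d) (at t within {0..})"
  shows "tderiv v t = d"
  unfolding tderiv_def
proof (rule vector_derivative_within[OF _ assms(2)])
  have "t islimpt {t..t + 1}" by simp
  then have "t islimpt {0..}" by (rule islimpt_subset) (use \<open>t \<ge> 0\<close> in auto)
  then show "at t within {0..} \<noteq> bot" by (simp add: trivial_limit_within)
qed

lemma global_solutionI:
  assumes v: "\<And>t. t \<ge> 0 \<Longrightarrow> (v has_vector_derivative v' t) (at t within {0..})"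
    and v': "\<And>t. t \<ge> 0 \<Longrightarrow> (v' has_vector_derivative grad V (v t)) (at t within {0..})"
    and cont: "continuous_on {0..} (\<lambda>t. grad V (v t))"
  shows "global_solution V v"
proof -
  have "tderiv (tderiv v) t = grad V (v t)" if "t \<ge> 0" for t
  proof (rule tderiv_eqI[OF that])
    show "(tderiv v has_vector_derivative grad V (v t)) (at t within {0..})"
      by (rule has_vector_derivative_transform[OF _ _ v'[OF that]]) (use that tderiv_eqI v in auto)
  qed
  moreover have "traj_C2 v"
    unfolding traj_C2_def
    by (intro exI[of _ v'] exI[of _ "\<lambda>t. grad V (v t)"] conjI allI impI assms)
  ultimately show ?thesis by (simp add: global_solution_def)
qed

lemma global_solutionE:
  assumes "global_solution V v"
  obtains v' where "\<And>t. t \<ge> 0 \<Longrightarrow> (v has_vector_derivative v' t) (at t within {0..})"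
    and "\<And>t. t \<ge> 0 \<Longrightarrow> (v' has_vector_derivative grad V (v t)) (at t within {0..})"
    and "\<And>t. t \<ge> 0 \<Longrightarrow> tderiv v t = v' t"
proof -
  obtain v' v'' where v: "\<And>t. t \<ge> 0 \<Longrightarrow> (v has_vector_derivative v' t) (at t within {0..})"
    and v': "\<And>t. t \<ge> 0 \<Longrightarrow> (v' has_vector_derivative v'' t) (at t within {0..})"
    using assms unfolding global_solution_def traj_C2_def by blast
  have td: "tderiv v t = v' t" if "t \<ge> 0" for t
    using tderiv_eqI[OF that v[OF that]] .
  have "v'' t = grad V (v t)" if "t \<ge> 0" for t
  proof -
    have "(tderiv v has_vector_derivative v'' t) (at t within {0..})"
      by (rule has_vector_derivative_transform[OF _ _ v'[OF that]]) (use that td in auto)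
    then show ?thesis
      using tderiv_eqI[OF that] assms that unfolding global_solution_def by metis
  qed
  with v v' td show ?thesis using that by metis
qed

lemma frequently_small_of_Liminf_zero:
  fixes f :: "real \<Rightarrow> real"
  assumes "Liminf at_top (\<lambda>t. ereal (f t)) = 0" "e > 0"
  obtains t where "t \<ge> N" "f t < e"
proof -
  have "\<exists>t\<ge>N. f t < e"
  proof (rule ccontr)
    assume "\<not> ?thesis"
    then have "\<forall>\<^sub>F t in at_top. ereal e \<le> ereal (f t)"
      by (intro eventually_mono[OF eventually_ge_at_top[of N]]) auto
    then have "ereal e \<le> Liminf at_top (\<lambda>t. ereal (f t))" by (rule Liminf_bounded)
    with assms show False by simp
  qed
  then show ?thesis using that by blast
qed

lemma Liminf_zero_of_tendsto_zero:
  fixes f :: "real \<Rightarrow> real"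
  assumes "(f \<longlongrightarrow> 0) at_top"
  shows "Liminf at_top (\<lambda>t. ereal (f t)) = 0"
  using lim_imp_Liminf[OF _ tendsto_ereal[OF assms]] by (simp add: zero_ereal_def)

section \<open>The gradient flow of a convex potential\<close>

text \<open>
\<open>A x\<close> is the Hessian of \<open>\<psi>\<close> at \<open>x\<close>. The existence of such an \<open>A\<close> for a convex function of class
\<open>C\<^sup>2\<close> is lemma \<open>class_C2_gradient\<close>.
\<close>

locale convex_C2_potential =
  fixes \<psi> :: "'a::{real_inner, complete_space} \<Rightarrow> real" and A :: "'a \<Rightarrow> 'a \<Rightarrow>\<^sub>L 'a"
  assumes convex: "convex_on UNIV \<psi>"
    and gradient: "(\<psi> has_derivative (\<lambda>h. grad \<psi> x \<bullet> h)) (at x)"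
    and hessian: "(grad \<psi> has_derivative blinfun_apply (A x)) (at x)"
    and hessian_continuous: "continuous_on UNIV A"
    and hessian_symmetric: "A x h \<bullet> k = A x k \<bullet> h"
begin

abbreviation g :: "'a \<Rightarrow> 'a" where "g \<equiv> grad \<psi>"

abbreviation V :: "'a \<Rightarrow> real" where "V \<equiv> \<lambda>x. (1/2) * (norm (g x))\<^sup>2"

lemmas above_tangent = convex_above_tangent[OF convex gradient]
lemmas gradient_monotone = convex_gradient_monotone[OF convex gradient]
lemmas hessian_nonneg = monotone_derivative_nonneg[OF gradient_monotone hessian]
lemmas grad_V = grad_half_norm_sq[OF hessian hessian_symmetric]

lemma gradient_continuous: "continuous_on S g"
  by (rule has_derivative_continuous_on[OF has_derivative_at_withinI[OF hessian]])

lemma descent_dissipative: "(- g x - - g y) \<bullet> (x - y) \<le> 0"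
  using gradient_monotone[of x y] by (simp add: inner_diff_left)

lemma flow_on_of_gradient_flow: "gradient_flow \<psi> u \<Longrightarrow> flow_on (\<lambda>x. - g x) T u"
  unfolding gradient_flow_def flow_on_def
  by (auto intro: has_vector_derivative_within_subset[where S = "{0..}"])

lemma gradient_flow_contraction:
  "gradient_flow \<psi> u \<Longrightarrow> gradient_flow \<psi> w \<Longrightarrow> t \<ge> 0 \<Longrightarrow> norm (u t - w t) \<le> norm (u 0 - w 0)"
  by (rule dissipative_flow_contraction[OF descent_dissipative, of t])
    (auto intro: flow_on_of_gradient_flow)

lemma gradient_flow_unique:
  "gradient_flow \<psi> u \<Longrightarrow> gradient_flow \<psi> w \<Longrightarrow> u 0 = w 0 \<Longrightarrow> t \<ge> 0 \<Longrightarrow> u t = w t"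
  using gradient_flow_contraction[of u w t] by simp

lemma gradient_flow_drift:
  "gradient_flow \<psi> u \<Longrightarrow> t \<ge> 0 \<Longrightarrow> norm (u t - z) \<le> norm (u 0 - z) + norm (g z) * t"
  using dissipative_flow_drift[OF descent_dissipative flow_on_of_gradient_flow, of u t t z] by simp

lemma gradient_flow_exists:
  obtains u where "gradient_flow \<psi> u" "u 0 = x"
proof -
  have "\<exists>r>0. \<exists>L. L-lipschitz_on (cball x r) (\<lambda>x. - g x)" for x
    using locally_lipschitz_of_continuous_derivative[OF hessian hessian_continuous, of x]
    by (auto simp: lipschitz_on_minus_iff)
  from dissipative_flow_exists[OF descent_dissipative this, of x] that
  show ?thesis unfolding gradient_flow_def by blast
qed

lemma gradient_flow_shift:
  assumes u: "gradient_flow \<psi> u" and "s \<ge> 0"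
  shows "gradient_flow \<psi> (\<lambda>t. u (t + s))"
  unfolding gradient_flow_def
proof (intro allI impI)
  fix t :: real assume "t \<ge> 0"
  have "(u has_vector_derivative - g (u (t + s))) (at (t + s) within (\<lambda>t. t + s) ` {0..})"
    by (rule has_vector_derivative_within_subset[where S = "{0..}"])
      (use u \<open>s \<ge> 0\<close> \<open>t \<ge> 0\<close> in \<open>auto simp: gradient_flow_def\<close>)
  moreover have "((\<lambda>t. t + s) has_vector_derivative 1) (at t within {0..})"
    by (auto intro!: derivative_eq_intros)
  ultimately show "((\<lambda>t. u (t + s)) has_vector_derivative - g (u (t + s))) (at t within {0..})"
    using vector_diff_chain_within[of "\<lambda>t. t + s" 1 t "{0..}" u] by (simp add: o_def)
qed

lemma potential_along_curve:
  assumes "(v has_vector_derivative d) (at t within S)"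
  shows "((\<lambda>t. \<psi> (v t)) has_real_derivative g (v t) \<bullet> d) (at t within S)"
  using has_derivative_compose[OF assms[unfolded has_vector_derivative_def] gradient]
  by (simp add: has_field_derivative_def mult_commute_abs)

lemma gradient_along_curve:
  assumes "(v has_vector_derivative d) (at t within S)"
  shows "((\<lambda>t. g (v t)) has_vector_derivative A (v t) d) (at t within S)"
  using has_derivative_compose[OF assms[unfolded has_vector_derivative_def] hessian]
  by (simp add: has_vector_derivative_def blinfun.scaleR_right)

lemma sq_dist_along_curve:
  fixes v :: "real \<Rightarrow> 'a"
  assumes "(v has_vector_derivative d) (at t within S)"
  shows "((\<lambda>t. (norm (v t - z))\<^sup>2) has_real_derivative 2 * (d \<bullet> (v t - z))) (at t within S)"
proof -
  have "((\<lambda>t. v t - z) has_vector_derivative d) (at t within S)"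
    using assms by (auto intro!: derivative_eq_intros)
  from bounded_bilinear.has_vector_derivative[OF bounded_bilinear_inner this this]
  show ?thesis
    by (simp add: has_real_derivative_iff_has_vector_derivative power2_norm_eq_inner
        inner_commute[of "v t - z" d])
qed

lemma gradient_flow_deriv:
  "gradient_flow \<psi> u \<Longrightarrow> a \<ge> 0 \<Longrightarrow> t \<in> {a..b} \<Longrightarrow> (u has_vector_derivative - g (u t)) (at t within {a..b})"
  unfolding gradient_flow_def
  by (rule has_vector_derivative_within_subset[where S = "{0..}"]) auto

lemma gradient_norm_decreasing:
  assumes u: "gradient_flow \<psi> u" and st: "0 \<le> s" "s \<le> t"
  shows "norm (g (u t)) \<le> norm (g (u s))"
proof -
  have "norm (g (u t)) \<le> norm (g (u s)) + 0 * (t - s)"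
    by (rule norm_growth_of_radial_speed[OF \<open>s \<le> t\<close> _
          gradient_along_curve[OF gradient_flow_deriv[OF u \<open>0 \<le> s\<close>]]])
      (use hessian_nonneg in \<open>auto simp: blinfun.minus_right\<close>)
  then show ?thesis by simp
qed

text \<open>
The potential decreases along the flow at rate \<open>norm (g (u s)) ^ 2\<close>, which at all earlier times
\<open>s \<le> t\<close> is at least its value at time \<open>t\<close>.
\<close>

lemma energy_dissipation:
  assumes u: "gradient_flow \<psi> u" and "t \<ge> 0"
  shows "t * (norm (g (u t)))\<^sup>2 \<le> \<psi> (u 0) - \<psi> (u t)"
proof -
  have "\<psi> (u t) + t * (norm (g (u t)))\<^sup>2 \<le> \<psi> (u 0) + 0 * (norm (g (u t)))\<^sup>2"
  proof (rule antimono_of_derivative_nonpos[OF \<open>t \<ge> 0\<close>])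
    fix s assume s: "s \<in> {0..t}"
    show "((\<lambda>s. \<psi> (u s) + s * (norm (g (u t)))\<^sup>2) has_real_derivative
        g (u s) \<bullet> (- g (u s)) + (norm (g (u t)))\<^sup>2) (at s within {0..t})"
      using potential_along_curve[OF gradient_flow_deriv[OF u _ s]]
      by (auto intro!: derivative_eq_intros)
    have "(norm (g (u t)))\<^sup>2 \<le> (norm (g (u s)))\<^sup>2"
      using gradient_norm_decreasing[OF u, of s t] s by (intro power_mono) auto
    then show "g (u s) \<bullet> (- g (u s)) + (norm (g (u t)))\<^sup>2 \<le> 0"
      by (simp add: power2_norm_eq_inner)
  qed
  then show ?thesis by simp
qed

text \<open>
The potential need not be bounded below, so \<open>\<psi> (u t)\<close> is compared with the tangent at a point \<open>z\<close>
where \<open>d = norm (g z)\<close> is small. Since \<open>u t\<close> moves away from \<open>z\<close> at speed at most \<open>d\<close>, this gives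
\<open>\<psi> (u t) \<ge> \<psi> z - d * (D + d * t)\<close>. Inserted into the energy estimate it yields
\<open>norm (g (u t)) ^ 2 \<le> C / t + d ^ 2\<close>.
\<close>

lemma gradient_vanishes_along_flow:
  assumes u: "gradient_flow \<psi> u" and inf: "\<And>e. e > 0 \<Longrightarrow> \<exists>z. norm (g z) < e"
  shows "((\<lambda>t. norm (g (u t))) \<longlongrightarrow> 0) at_top"
proof (rule tendstoI)
  fix e :: real assume "e > 0"
  then obtain z where z: "norm (g z) < e / 2" using inf[of "e / 2"] by auto
  define d D where "d = norm (g z)" and "D = norm (u 0 - z)"
  define C where "C = \<psi> (u 0) - \<psi> z + d * D"
  have main: "t * (norm (g (u t)))\<^sup>2 \<le> C + t * d\<^sup>2" if "t \<ge> 0" for t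
  proof -
    have "- (g z \<bullet> (u t - z)) \<le> d * norm (u t - z)"
      using Cauchy_Schwarz_ineq2[of "g z" "u t - z"] by (simp add: d_def)
    also have "\<dots> \<le> d * (D + d * t)"
      using gradient_flow_drift[OF u that, of z] unfolding d_def D_def by (intro mult_left_mono) auto
    finally show ?thesis
      using energy_dissipation[OF u that] above_tangent[of z "u t"]
      by (simp add: C_def power2_eq_square algebra_simps)
  qed
  have d2: "d\<^sup>2 \<le> e\<^sup>2 / 4"
    using power_mono[of d "e / 2" 2] z by (simp add: d_def power_divide)
  have "\<forall>\<^sub>F t in at_top. t > max 0 (2 * C / e\<^sup>2)" by (rule eventually_gt_at_top)
  then show "\<forall>\<^sub>F t in at_top. dist (norm (g (u t))) 0 < e"
  proof eventually_elim
    case (elim t)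
    then have "t > 0" and "2 * C / e\<^sup>2 < t" by auto
    then have "C < t * (e\<^sup>2 / 2)" using \<open>e > 0\<close> by (simp add: divide_less_eq)
    then have "t * (norm (g (u t)))\<^sup>2 < t * (e\<^sup>2 / 2) + t * (e\<^sup>2 / 4)"
      using main[of t] \<open>t > 0\<close> mult_left_mono[OF d2, of t] by linarith
    also have "\<dots> \<le> t * e\<^sup>2" using \<open>t > 0\<close> by simp
    finally have "(norm (g (u t)))\<^sup>2 < e\<^sup>2" using \<open>t > 0\<close> by simp
    then show ?case using \<open>e > 0\<close> by (auto intro: power2_less_imp_less)
  qed
qed

text \<open>
If \<open>\<psi> z\<close> lay below all values along the flow by a fixed amount, then by the tangent inequality
\<open>norm (u t - z) ^ 2\<close> would decrease at a rate bounded away from zero and become negative.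
\<close>

lemma flow_reaches_infimum:
  assumes u: "gradient_flow \<psi> u" and m: "\<And>t. t \<ge> 0 \<Longrightarrow> m \<le> \<psi> (u t)"
  shows "m \<le> \<psi> z"
proof (rule ccontr)
  assume "\<not> m \<le> \<psi> z"
  then have gap: "m - \<psi> z > 0" by simp
  define D where "D = (norm (u 0 - z))\<^sup>2"
  have bound: "2 * (m - \<psi> z) * t \<le> D" if "t \<ge> 0" for t
  proof -
    have "(norm (u t - z))\<^sup>2 + 2 * (m - \<psi> z) * t \<le> (norm (u 0 - z))\<^sup>2 + 2 * (m - \<psi> z) * 0"
    proof (rule antimono_of_derivative_nonpos[OF that])
      fix s assume s: "s \<in> {0..t}"
      show "((\<lambda>s. (norm (u s - z))\<^sup>2 + 2 * (m - \<psi> z) * s) has_real_derivative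
          2 * (- g (u s) \<bullet> (u s - z)) + 2 * (m - \<psi> z)) (at s within {0..t})"
        by (intro DERIV_add sq_dist_along_curve gradient_flow_deriv[OF u _ s] DERIV_cmult_Id) simp
      show "2 * (- g (u s) \<bullet> (u s - z)) + 2 * (m - \<psi> z) \<le> 0"
        using above_tangent[of "u s" z] m[of s] s by (simp add: inner_diff_right)
    qed
    then show ?thesis using zero_le_power2[of "norm (u t - z)"] unfolding D_def by linarith
  qed
  have "D \<ge> 0" by (simp add: D_def)
  define T where "T = D / (m - \<psi> z)"
  have "T \<ge> 0" "(m - \<psi> z) * T = D" using gap \<open>D \<ge> 0\<close> by (simp_all add: T_def)
  moreover have "2 * (m - \<psi> z) * (T + 1) = 2 * ((m - \<psi> z) * T) + 2 * (m - \<psi> z)"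
    by (simp add: algebra_simps)
  ultimately have "2 * D + 2 * (m - \<psi> z) \<le> D"
    using bound[of "T + 1"] by simp
  with gap \<open>D \<ge> 0\<close> show False by simp
qed

lemma gradient_flow_continuous: "gradient_flow \<psi> u \<Longrightarrow> continuous_on {0..} u"
  unfolding gradient_flow_def
  by (meson atLeast_iff continuous_on_eq_continuous_within has_vector_derivative_continuous)

section \<open>Evanescent solutions\<close>

text \<open>
Differentiating \<open>u' = - g u\<close> gives \<open>u'' = - A u u' = A u (g u)\<close>, which is the gradient of \<open>V\<close>.
\<close>

lemma gradient_flow_global_solution:
  assumes u: "gradient_flow \<psi> u"
  shows "global_solution V u" and "t \<ge> 0 \<Longrightarrow> tderiv u t = - g (u t)"
proof -
  have D: "(u has_vector_derivative - g (u t)) (at t within {0..})" if "t \<ge> 0" for t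
    using u that by (simp add: gradient_flow_def)
  show "global_solution V u"
  proof (rule global_solutionI[OF D])
    show "((\<lambda>t. - g (u t)) has_vector_derivative grad V (u t)) (at t within {0..})" if "t \<ge> 0" for t
      using has_vector_derivative_minus[OF gradient_along_curve[OF D[OF that]]]
      unfolding grad_V by (simp add: blinfun.minus_right)
    have "continuous_on {0..} (\<lambda>t. A (u t) (g (u t)))"
      by (intro continuous_intros continuous_on_compose2[OF hessian_continuous]
          continuous_on_compose2[OF gradient_continuous[of UNIV]] gradient_flow_continuous u) auto
    then show "continuous_on {0..} (\<lambda>t. grad V (u t))" unfolding grad_V .
  qed auto
  show "t \<ge> 0 \<Longrightarrow> tderiv u t = - g (u t)"
    using D tderiv_eqI by blast
qed

text \<open>
The defect \<open>w = v' + g v\<close> satisfies the linear equation \<open>w' = A v w\<close>, and since the Hessian is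
nonnegative, \<open>norm w\<close> does not decrease. On the other hand the energy \<open>norm v' ^ 2 - norm (g v) ^ 2\<close>
is constant, and the two limits inferior force it to be zero. Hence \<open>norm w \<le> 2 * norm v'\<close> becomes
arbitrarily small at late times, so \<open>w\<close> is zero throughout.
\<close>

lemma w_evanescent_imp_gradient_flow:
  assumes "w_evanescent V v"
  shows "gradient_flow \<psi> v"
proof -
  have sol: "global_solution V v" using assms by (simp add: w_evanescent_def)
  obtain v' where v: "\<And>t. t \<ge> 0 \<Longrightarrow> (v has_vector_derivative v' t) (at t within {0..})"
    and v'_grad: "\<And>t. t \<ge> 0 \<Longrightarrow> (v' has_vector_derivative grad V (v t)) (at t within {0..})"
    and td: "\<And>t. t \<ge> 0 \<Longrightarrow> tderiv v t = v' t"
    by (rule global_solutionE[OF sol]) (rule that; simp)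
  have v': "(v' has_vector_derivative A (v t) (g (v t))) (at t within {0..})" if "t \<ge> 0" for t
    using v'_grad[OF that] unfolding grad_V .
  have speed_small: "\<exists>t\<ge>N. 0 \<le> t \<and> norm (v' t) < e" if "e > 0" for e N
  proof -
    have "Liminf at_top (\<lambda>t. ereal (norm (tderiv v t))) = 0"
      using assms unfolding w_evanescent_def by blast
    from frequently_small_of_Liminf_zero[OF this \<open>e > 0\<close>, of "max N 0"]
    obtain t where "t \<ge> max N 0" "norm (tderiv v t) < e" by blast
    then show ?thesis using td[of t] by auto
  qed
  have V_small: "\<exists>t\<ge>0. V (v t) < e" if "e > 0" for e
  proof -
    have "Liminf at_top (\<lambda>t. ereal (V (v t))) = 0"
      using assms unfolding w_evanescent_def by blast
    from frequently_small_of_Liminf_zero[OF this \<open>e > 0\<close>, of 0] show ?thesis by blast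
  qed
  have "\<exists>k. \<forall>t\<in>{0..}. (norm (v' t))\<^sup>2 - (norm (g (v t)))\<^sup>2 = k"
  proof -
    have "((\<lambda>t. (norm (v' t - 0))\<^sup>2 - (norm (g (v t) - 0))\<^sup>2) has_real_derivative 0) (at t within {0..})"
      if "t \<in> {0..}" for t
      using DERIV_diff[OF sq_dist_along_curve[OF v', of t 0]
          sq_dist_along_curve[OF gradient_along_curve[OF v], of t 0]] that
      by (simp add: hessian_symmetric[of _ "v' t"])
    from has_field_derivative_zero_constant[OF _ this] show ?thesis by auto
  qed
  then obtain k where k: "\<And>t. t \<ge> 0 \<Longrightarrow> (norm (v' t))\<^sup>2 - (norm (g (v t)))\<^sup>2 = k" by auto
  \<comment> \<open>The two limits inferior may be attained along different sequences of times: small \<open>v'\<close> bounds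
    \<open>k\<close> from above, small \<open>V\<close> bounds it from below.\<close>
  have "k \<le> 0"
  proof (rule ccontr)
    assume "\<not> k \<le> 0"
    then obtain t where t: "t \<ge> 0" "norm (v' t) < sqrt k" using speed_small[of "sqrt k" 0] by auto
    then have "(norm (v' t))\<^sup>2 < k"
      using power_strict_mono[of "norm (v' t)" "sqrt k" 2] \<open>\<not> k \<le> 0\<close> by simp
    then show False using k[OF t(1)] zero_le_power2[of "norm (g (v t))"] by linarith
  qed
  moreover have "k \<ge> 0"
  proof (rule ccontr)
    assume "\<not> k \<ge> 0"
    then obtain t where t: "t \<ge> 0" "V (v t) < - k / 2" using V_small[of "- k / 2"] by auto
    then show False using k[OF t(1)] zero_le_power2[of "norm (v' t)"] by linarith
  qed
  ultimately have speed: "norm (v' t) = norm (g (v t))" if "t \<ge> 0" for t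
    using k[OF that] by simp
  define w where "w t = v' t + g (v t)" for t
  have w: "(w has_vector_derivative A (v t) (w t)) (at t within {0..})" if "t \<ge> 0" for t
    unfolding w_def
    using has_vector_derivative_add[OF v' gradient_along_curve[OF v], OF that that]
    by (simp add: blinfun.add_right add.commute)
  have grows: "(norm (w s))\<^sup>2 \<le> (norm (w t))\<^sup>2" if "0 \<le> s" "s \<le> t" for s t
  proof -
    have "- (norm (w t - 0))\<^sup>2 \<le> - (norm (w s - 0))\<^sup>2"
    proof (rule antimono_of_derivative_nonpos[OF \<open>s \<le> t\<close>])
      fix r assume r: "r \<in> {s..t}"
      have "(w has_vector_derivative A (v r) (w r)) (at r within {s..t})"
        by (rule has_vector_derivative_within_subset[OF w]) (use r that in auto)
      from DERIV_minus[OF sq_dist_along_curve[OF this, of 0]]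
      show "((\<lambda>r. - (norm (w r - 0))\<^sup>2) has_real_derivative
          - (2 * (A (v r) (w r) \<bullet> (w r - 0)))) (at r within {s..t})" .
      show "- (2 * (A (v r) (w r) \<bullet> (w r - 0))) \<le> 0"
        using hessian_nonneg[of "v r" "w r"] by simp
    qed
    then show ?thesis by simp
  qed
  have "w s = 0" if "s \<ge> 0" for s
  proof -
    have "norm (w s) \<le> 0 + e" if "e > 0" for e
    proof -
      obtain t where t: "t \<ge> s" "t \<ge> 0" "norm (v' t) < e / 2"
        using speed_small[of "e / 2" s] \<open>e > 0\<close> by auto
      have "norm (w s) \<le> norm (w t)"
        using grows[OF \<open>s \<ge> 0\<close> t(1)] by (rule power2_le_imp_le) simp
      also have "\<dots> \<le> norm (v' t) + norm (g (v t))"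
        unfolding w_def by (rule norm_triangle_ineq)
      also have "\<dots> < e" using t(3) speed[OF t(2)] by simp
      finally show ?thesis by simp
    qed
    then have "norm (w s) \<le> 0" by (rule field_le_epsilon)
    then show ?thesis by simp
  qed
  then have "v' t = - g (v t)" if "t \<ge> 0" for t
    using that unfolding w_def by (simp add: add_eq_0_iff2)
  with v show ?thesis unfolding gradient_flow_def by metis
qed

lemma gradient_flow_w_evanescent:
  assumes u: "gradient_flow \<psi> u" and inf: "\<And>e. e > 0 \<Longrightarrow> \<exists>z. norm (g z) < e"
  shows "w_evanescent V u"
proof -
  note lim = gradient_vanishes_along_flow[OF u inf]
  have "((\<lambda>t. norm (tderiv u t)) \<longlongrightarrow> 0) at_top"
    using lim
  proof (rule Lim_transform_eventually)
    show "\<forall>\<^sub>F t in at_top. norm (g (u t)) = norm (tderiv u t)"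
      using eventually_ge_at_top[of 0]
      by eventually_elim (simp add: gradient_flow_global_solution(2)[OF u])
  qed
  moreover have "((\<lambda>t. V (u t)) \<longlongrightarrow> 0) at_top"
    using tendsto_mult[OF tendsto_const[of "1/2"] tendsto_power[OF lim, of 2]] by simp
  ultimately show ?thesis
    unfolding w_evanescent_def
    by (intro conjI gradient_flow_global_solution(1)[OF u] Liminf_zero_of_tendsto_zero)
qed

text \<open>
Along the flow the integrand is \<open>3/2\<close> times the rate at which the potential decreases, so the
integral is finite exactly if the potential stays bounded below along the flow; and the infimum along
the flow is the global one.
\<close>

lemma strongly_evanescent_flow_iff:
  assumes u: "gradient_flow \<psi> u"
  shows "strongly_evanescent V u \<longleftrightarrow> bdd_below (range \<psi>)"
proof -
  let ?f = "\<lambda>t. (3/2) * (norm (g (u t)))\<^sup>2" and ?F = "\<lambda>t. - (3/2) * \<psi> (u t)"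
  have "(\<integral>\<^sup>+t\<in>{0..}. ennreal ((norm (tderiv u t))\<^sup>2 + V (u t)) \<partial>lborel)
      = (\<integral>\<^sup>+t\<in>{0..}. ennreal (?f t) \<partial>lborel)"
  proof (rule nn_integral_cong)
    fix t :: real
    have "(norm (tderiv u t))\<^sup>2 + V (u t) = ?f t" if "t \<ge> 0"
      using gradient_flow_global_solution(2)[OF u that] by simp
    then show "ennreal ((norm (tderiv u t))\<^sup>2 + V (u t)) * indicator {0..} t
        = ennreal (?f t) * indicator {0..} t"
      by (cases "t \<ge> 0") (simp_all only: indicator_simps atLeast_iff mult_zero_right not_False_eq_True)
  qed
  also have "\<dots> < \<infinity> \<longleftrightarrow> bdd_above (?F ` {0..})"
  proof (rule nn_integral_halfline_finite_iff)
    show "(?F has_real_derivative ?f t) (at t within {0..})" if "t \<ge> 0" for t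
    proof -
      have "((\<lambda>t. \<psi> (u t)) has_real_derivative g (u t) \<bullet> (- g (u t))) (at t within {0..})"
        using u that by (intro potential_along_curve) (simp add: gradient_flow_def)
      from DERIV_cmult[OF this, of "- (3/2)"] show ?thesis
        by (simp add: power2_norm_eq_inner)
    qed
    show "continuous_on {0..} ?f"
      by (intro continuous_intros continuous_on_compose2[OF gradient_continuous[of UNIV]]
          gradient_flow_continuous u) auto
  qed simp
  also have "\<dots> \<longleftrightarrow> bdd_below (range \<psi>)"
  proof
    assume "bdd_above (?F ` {0..})"
    then obtain B where B: "\<And>t. t \<ge> 0 \<Longrightarrow> - (3/2) * \<psi> (u t) \<le> B" by (auto simp: bdd_above_def)
    then have "- (2/3) * B \<le> \<psi> (u t)" if "t \<ge> 0" for t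
      using B[OF that] by simp
    then have "- (2/3) * B \<le> \<psi> z" for z
      by (rule flow_reaches_infimum[OF u])
    then show "bdd_below (range \<psi>)" by (auto intro!: bdd_belowI)
  next
    assume "bdd_below (range \<psi>)"
    then obtain m where "\<And>x. m \<le> \<psi> x" by (auto simp: bdd_below_def)
    then show "bdd_above (?F ` {0..})"
      by (intro bdd_aboveI[where M = "- (3/2) * m"]) auto
  qed
  finally show ?thesis
    unfolding strongly_evanescent_def
    by (simp only: gradient_flow_global_solution(1)[OF u] simp_thms)
qed

text \<open>
A critical point is a rest point of the flow, and distances to it do not increase. Conversely, let
\<open>c\<close> be the asymptotic center of a bounded trajectory \<open>u\<close>. The flow is nonexpansive and maps \<open>u\<close>
to a time shift of itself, so the point reached from \<open>c\<close> after time \<open>s\<close> is asymptotically no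
farther from \<open>u\<close> than \<open>c\<close>. Hence \<open>c\<close> does not move, which means \<open>g c = 0\<close>.
\<close>

lemma bounded_flow_iff:
  assumes u: "gradient_flow \<psi> u"
  shows "bounded (u ` {0..}) \<longleftrightarrow> Crit \<psi> \<noteq> {}"
proof
  assume "Crit \<psi> \<noteq> {}"
  then obtain z where z: "g z = 0" by (auto simp: Crit_def)
  have "norm (u t) \<le> norm (u 0 - z) + norm z" if "t \<ge> 0" for t
    using gradient_flow_drift[OF u that, of z] z norm_triangle_sub[of "u t" z] by simp
  then show "bounded (u ` {0..})" by (intro boundedI) auto
next
  assume bdd: "bounded (u ` {0..})"
  obtain c where c: "\<And>y. (\<And>r. \<forall>\<^sub>F t in at_top. norm (u t - c) \<le> r \<Longrightarrow> \<forall>\<^sub>F t in at_top. norm (u t - y) \<le> r)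
      \<Longrightarrow> y = c"
    using asymptotic_center[OF bdd] by blast
  obtain w where w: "gradient_flow \<psi> w" "w 0 = c" by (rule gradient_flow_exists)
  have fixed: "w s = c" if "s \<ge> 0" for s
  proof (rule c)
    fix r assume "\<forall>\<^sub>F t in at_top. norm (u t - c) \<le> r"
    then obtain N where N: "\<And>t. t \<ge> N \<Longrightarrow> norm (u t - c) \<le> r"
      by (auto simp: eventually_at_top_linorder)
    have "norm (u t - w s) \<le> r" if "t \<ge> max N 0 + s" for t
    proof -
      have "norm (u (s + (t - s)) - w s) \<le> norm (u (0 + (t - s)) - w 0)"
        using that \<open>s \<ge> 0\<close> by (intro gradient_flow_contraction gradient_flow_shift u w) auto
      also have "\<dots> \<le> r" using N[of "t - s"] that w by simp
      finally show ?thesis by simp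
    qed
    then show "\<forall>\<^sub>F t in at_top. norm (u t - w s) \<le> r"
      unfolding eventually_at_top_linorder by blast
  qed
  have "(w has_vector_derivative 0) (at 0 within {0..})"
    by (rule has_vector_derivative_transform[where f = "\<lambda>_. c"]) (use fixed in auto)
  then have "tderiv w 0 = 0" by (rule tderiv_eqI[rotated]) simp
  then have "g c = 0" using gradient_flow_global_solution(2)[OF w(1), of 0] w(2) by simp
  then show "Crit \<psi> \<noteq> {}" by (auto simp: Crit_def)
qed

lemma Inf_gradient_norm_zero_iff:
  "(INF z. norm (g z)) = 0 \<longleftrightarrow> (\<forall>e>0. \<exists>z. norm (g z) < e)"
proof -
  have bdd: "bdd_below (range (\<lambda>z. norm (g z)))" by (rule bdd_belowI[where m = 0]) auto
  have "0 \<le> (INF z. norm (g z))" by (rule cINF_greatest) auto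
  then have "(INF z. norm (g z)) = 0 \<longleftrightarrow> (\<forall>e>0. (INF z. norm (g z)) < e)"
    by (metis dual_order.irrefl order_le_less)
  also have "\<dots> \<longleftrightarrow> (\<forall>e>0. \<exists>z. norm (g z) < e)"
    using cINF_less_iff[OF _ bdd] by auto
  finally show ?thesis .
qed

lemma w_evanescent_imp_Inf_gradient_norm_zero:
  assumes "w_evanescent V v"
  shows "(INF z. norm (g z)) = 0"
  unfolding Inf_gradient_norm_zero_iff
proof (intro allI impI)
  fix e :: real assume "e > 0"
  then obtain t where "V (v t) < e\<^sup>2 / 2"
    using frequently_small_of_Liminf_zero[of "\<lambda>t. V (v t)" "e\<^sup>2 / 2" 0] assms
    by (auto simp: w_evanescent_def)
  then have "norm (g (v t)) < e"
    using \<open>e > 0\<close> by (auto intro: power2_less_imp_less)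
  then show "\<exists>z. norm (g z) < e" by blast
qed

end

theorem theorem3p6:
  fixes \<psi> V :: "'a::{real_inner, complete_space} \<Rightarrow> real" and u0 :: 'a
  assumes "convex_on UNIV \<psi>"
    and "class_C2 \<psi>"
    and "\<And>x. V x = (1/2) * (norm (grad \<psi> x))\<^sup>2"
  shows "((\<exists>v. w_evanescent V v \<and> v 0 = u0) \<longleftrightarrow> (INF z. norm (grad \<psi> z)) = 0) \<and>
    ((INF z. norm (grad \<psi> z)) = 0 \<longrightarrow>
      (\<exists>v. w_evanescent V v \<and> v 0 = u0 \<and>
        (\<forall>w. w_evanescent V w \<and> w 0 = u0 \<longrightarrow> (\<forall>t\<ge>0. w t = v t)) \<and>
        gradient_flow \<psi> v \<and>
        (\<forall>u. gradient_flow \<psi> u \<and> u 0 = u0 \<longrightarrow> (\<forall>t\<ge>0. u t = v t)) \<and>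
        (strongly_evanescent V v \<longleftrightarrow> bdd_below (range \<psi>)) \<and>
        (bounded (v ` {0..}) \<longleftrightarrow> Crit \<psi> \<noteq> {})))"
proof -
  obtain A :: "'a \<Rightarrow> 'a \<Rightarrow>\<^sub>L 'a" where "convex_C2_potential \<psi> A"
    using class_C2_gradient[OF assms(2)] assms(1) unfolding convex_C2_potential_def by metis
  then interpret convex_C2_potential \<psi> A .
  have V: "V = (\<lambda>x. (1/2) * (norm (grad \<psi> x))\<^sup>2)" using assms(3) by (rule ext)
  obtain v where v: "gradient_flow \<psi> v" "v 0 = u0" by (rule gradient_flow_exists)
  have evan: "w_evanescent V v" if "(INF z. norm (grad \<psi> z)) = 0"
    using gradient_flow_w_evanescent[OF v(1)] that unfolding V Inf_gradient_norm_zero_iff by blast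
  have flow_unique: "\<forall>t\<ge>0. u t = v t" if "gradient_flow \<psi> u" "u 0 = u0" for u
    using gradient_flow_unique[OF that(1) v(1)] that(2) v(2) by simp
  have evan_unique: "\<forall>t\<ge>0. w t = v t" if "w_evanescent V w" "w 0 = u0" for w
  proof -
    have "gradient_flow \<psi> w"
      using that(1) unfolding V by (rule w_evanescent_imp_gradient_flow)
    then show ?thesis using that(2) by (rule flow_unique)
  qed
  have Inf_zero: "(INF z. norm (grad \<psi> z)) = 0" if "w_evanescent V w" for w
    using that unfolding V by (rule w_evanescent_imp_Inf_gradient_norm_zero)
  have strong: "strongly_evanescent V v \<longleftrightarrow> bdd_below (range \<psi>)"
    unfolding V by (rule strongly_evanescent_flow_iff[OF v(1)])
  show ?thesis
  proof (intro conjI impI)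
    show "(\<exists>v. w_evanescent V v \<and> v 0 = u0) \<longleftrightarrow> (INF z. norm (grad \<psi> z)) = 0"
      using Inf_zero evan v(2) by blast
  next
    assume "(INF z. norm (grad \<psi> z)) = 0"
    then show "\<exists>v. w_evanescent V v \<and> v 0 = u0 \<and>
        (\<forall>w. w_evanescent V w \<and> w 0 = u0 \<longrightarrow> (\<forall>t\<ge>0. w t = v t)) \<and>
        gradient_flow \<psi> v \<and>
        (\<forall>u. gradient_flow \<psi> u \<and> u 0 = u0 \<longrightarrow> (\<forall>t\<ge>0. u t = v t)) \<and>
        (strongly_evanescent V v \<longleftrightarrow> bdd_below (range \<psi>)) \<and>
        (bounded (v ` {0..}) \<longleftrightarrow> Crit \<psi> \<noteq> {})"
      by (intro exI[of _ v] conjI evan v strong bounded_flow_iff[OF v(1)])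
        (use flow_unique evan_unique in blast)+
  qed
qed

end
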